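(* Let $X$ be a semi-equivelar map of type $[4^3,5^1]$ on the surface of Euler characteristic $-1$. Then $X$ is isomorphic to $\mathcal{K}_1$, $\mathcal{K}_2$ or $\mathcal{K}_3$, where $\mathcal{K}_1,\mathcal{K}_2,\mathcal{K}_3$ are the explicit 20-vertex maps given by their lists of faces in the context.
   Context: A map is a finite connected 2-dimensional cell complex whose underlying space is a closed surface (equivalently, a cellular embedding of a finite connected simple graph in a closed surface). All maps are polyhedral: every face is a closed disc bounded by a cycle of length at least $3$, every vertex has degree at least $3$, and two distinct faces intersect in the empty set, a single vertex or a single edge. Two maps are isomorphic if there is a bijection between their vertex sets which induces a bijection between their face sets. A map is semi-equivelar of type $[4^3,5^1]$ if around every vertex the faces are, in cyclic order, three 4-gons and one 5-gon. The surface of Euler characteristic $-1$ is the closed non-orientable surface of Euler genus $3$. A face is written as the cyclic sequence of its vertices. The maps $\mathcal{K}_1,\mathcal{K}_2,\mathcal{K}_3$ have vertex set $\{1,\dots,20\}$ and the following faces. $\mathcal{K}_1$: 5-gons $[1,2,10,9,8]$, $[3,4,18,15,14]$, $[5,12,19,17,16]$, $[6,7,20,13,11]$; 4-gons $[12,3,2,11]$, $[3,4,1,2]$, $[4,5,6,1]$, $[5,12,11,6]$, $[1,6,7,8]$, $[4,5,16,18]$, $[18,16,10,13]$, $[2,11,13,10]$, $[12,3,14,19]$, $[19,7,8,14]$, $[8,9,15,14]$, $[15,18,13,20]$, $[9,17,20,15]$, $[16,17,9,10]$, $[17,19,7,20]$. $\mathcal{K}_2$: 5-gons $[1,2,10,9,8]$,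 $[3,4,19,18,16]$, $[5,11,13,15,14]$, $[6,7,20,17,12]$; 4-gons $[1,6,7,8]$, $[1,4,5,6]$, $[4,5,14,19]$, $[7,8,14,19]$, $[8,9,15,14]$, $[1,2,3,4]$, $[19,7,20,18]$, $[2,10,13,11]$, $[2,3,12,11]$, $[3,16,17,12]$, $[10,16,18,13]$, $[16,10,9,17]$, $[11,12,6,5]$, $[18,20,15,13]$, $[17,9,15,20]$. $\mathcal{K}_3$: 5-gons $[1,2,10,9,8]$, $[3,4,19,17,16]$, $[5,11,13,15,14]$, $[6,7,20,18,12]$; 4-gons $[1,6,7,8]$, $[1,4,5,6]$, $[4,5,14,19]$, $[7,8,14,19]$, $[8,9,15,14]$, $[1,2,3,4]$, $[19,7,20,17]$, $[2,10,13,11]$, $[2,3,12,11]$, $[3,16,18,12]$, $[10,16,18,13]$, $[16,10,9,17]$, $[11,12,6,5]$, $[18,20,15,13]$, $[17,9,15,20]$. *)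

theory Defs
  imports "HOL-Analysis.Analysis"
begin

section \<open>Cell complexes on closed surfaces\<close>

definition closed_surface :: "'a topology \<Rightarrow> bool" where
  "closed_surface S \<longleftrightarrow>
     topspace S \<noteq> {} \<and> compact_space S \<and> connected_space S \<and> Hausdorff_space S \<and>
     (\<forall>x\<in>topspace S. \<exists>U. openin S U \<and> x \<in> U \<and>
        subtopology S U homeomorphic_space (euclidean :: (real^2) topology))"

text \<open>Edges and faces are the closed cells, given as subsets of the underlying space; vertices are
  points of it. The ends of an edge \<open>e\<close> are then \<open>e \<inter> vertices M\<close>.\<close>

record 'a cell_map =
  surface  :: "'a topology"
  vertices :: "'a set"
  edges    :: "'a set set"
  faces    :: "'a set set"

definition skeleton :: "'a cell_map \<Rightarrow> 'a set" where
  "skeleton M = vertices M \<union> \<Union>(edges M)"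

definition face_edges :: "'a cell_map \<Rightarrow> 'a set \<Rightarrow> 'a set set" where
  "face_edges M f = {e \<in> edges M. e \<subseteq> f}"

text \<open>A cyclic sequence of vertices (a list up to rotation and reversal) is represented by the set
  of its unordered pairs of consecutive entries.\<close>

definition cycle_edges :: "'v list \<Rightarrow> 'v set set" where
  "cycle_edges vs = {{vs ! i, vs ! (Suc i mod length vs)} | i. i < length vs}"

definition boundary_cycle :: "'a cell_map \<Rightarrow> 'a set \<Rightarrow> 'a set set" where
  "boundary_cycle M f = (\<lambda>e. e \<inter> vertices M) ` face_edges M f"

definition is_edge_cell :: "'a cell_map \<Rightarrow> 'a set \<Rightarrow> bool" where
  "is_edge_cell M e \<longleftrightarrow>
     (\<exists>g. homeomorphic_map (top_of_set {0..1::real}) (subtopology (surface M) e) g \<and>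
          e \<inter> vertices M = {g 0, g 1})"

definition is_face_cell :: "'a cell_map \<Rightarrow> 'a set \<Rightarrow> bool" where
  "is_face_cell M f \<longleftrightarrow>
     (\<exists>h. homeomorphic_map (top_of_set (cball (0::real^2) 1)) (subtopology (surface M) f) h \<and>
          f \<inter> skeleton M = h ` sphere 0 1 \<and>
          h ` sphere 0 1 = \<Union>(face_edges M f)) \<and>
     (\<exists>vs. distinct vs \<and> 3 \<le> length vs \<and> set vs \<subseteq> vertices M \<and>
           boundary_cycle M f = cycle_edges vs)"

text \<open>The injectivity condition says that the graph has no parallel edges; loops are excluded by
  the edges being arcs.\<close>

definition is_map :: "'a cell_map \<Rightarrow> bool" where
  "is_map M \<longleftrightarrow>
     closed_surface (surface M) \<and>
     finite (vertices M) \<and> finite (edges M) \<and> finite (faces M) \<and>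
     topspace (surface M) = skeleton M \<union> \<Union>(faces M) \<and>
     (\<forall>e\<in>edges M. is_edge_cell M e) \<and>
     (\<forall>e\<in>edges M. \<forall>e'\<in>edges M. e \<noteq> e' \<longrightarrow> e \<inter> e' \<subseteq> vertices M) \<and>
     inj_on (\<lambda>e. e \<inter> vertices M) (edges M) \<and>
     (\<forall>f\<in>faces M. is_face_cell M f) \<and>
     (\<forall>f\<in>faces M. \<forall>f'\<in>faces M. f \<noteq> f' \<longrightarrow> f \<inter> f' \<subseteq> skeleton M)"

definition polyhedral_map :: "'a cell_map \<Rightarrow> bool" where
  "polyhedral_map M \<longleftrightarrow>
     is_map M \<and>
     (\<forall>v\<in>vertices M. 3 \<le> card {e \<in> edges M. v \<in> e}) \<and>
     (\<forall>f\<in>faces M. \<forall>f'\<in>faces M. f \<noteq> f' \<longrightarrow>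
        f \<inter> f' = {} \<or> (\<exists>v\<in>vertices M. f \<inter> f' = {v}) \<or> f \<inter> f' \<in> edges M)"

definition euler_char :: "'a cell_map \<Rightarrow> int" where
  "euler_char M = int (card (vertices M)) - int (card (edges M)) + int (card (faces M))"

section \<open>Semi-equivelar maps\<close>

text \<open>\<open>fs\<close> lists the faces around the vertex \<open>v\<close> in cyclic order: there is a cyclic list of all the
  edges at \<open>v\<close> such that the \<open>i\<close>-th face has exactly the \<open>i\<close>-th and the next edge at \<open>v\<close>.\<close>

definition faces_around :: "'a cell_map \<Rightarrow> 'a \<Rightarrow> 'a set list \<Rightarrow> bool" where
  "faces_around M v fs \<longleftrightarrow>
     distinct fs \<and> set fs = {f \<in> faces M. v \<in> f} \<and>
     (\<exists>es. distinct es \<and> set es = {e \<in> edges M. v \<in> e} \<and> length es = length fs \<and>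
        (\<forall>i < length fs. {e \<in> face_edges M (fs ! i). v \<in> e} =
                          {es ! i, es ! (Suc i mod length es)}))"

text \<open>The list \<open>ts\<close> of face sizes matters only up to rotation and reversal, as \<open>fs\<close> may start at
  any face and go in either direction.\<close>

definition semi_equivelar :: "nat list \<Rightarrow> 'a cell_map \<Rightarrow> bool" where
  "semi_equivelar ts M \<longleftrightarrow>
     polyhedral_map M \<and>
     (\<forall>v\<in>vertices M. \<exists>fs. faces_around M v fs \<and>
        map (\<lambda>f. card (face_edges M f)) fs = ts)"

section \<open>Maps given by face lists\<close>

text \<open>A pair \<open>(W, C)\<close> presents a map by its vertex set and the cyclic vertex sequences of its
  faces.\<close>

definition isomorphic_to :: "'a cell_map \<Rightarrow> 'b set \<times> 'b list set \<Rightarrow> bool" where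
  "isomorphic_to M K \<longleftrightarrow>
     (\<exists>b. bij_betw b (vertices M) (fst K) \<and>
          bij_betw (\<lambda>f. (image b) ` boundary_cycle M f) (faces M) (cycle_edges ` snd K))"

definition K1 :: "nat set \<times> nat list set" where
  "K1 = ({1..20},
    {[1,2,10,9,8], [3,4,18,15,14], [5,12,19,17,16], [6,7,20,13,11],
     [12,3,2,11], [3,4,1,2], [4,5,6,1], [5,12,11,6], [1,6,7,8],
     [4,5,16,18], [18,16,10,13], [2,11,13,10], [12,3,14,19], [19,7,8,14],
     [8,9,15,14], [15,18,13,20], [9,17,20,15], [16,17,9,10], [17,19,7,20]})"

definition K2 :: "nat set \<times> nat list set" where
  "K2 = ({1..20},
    {[1,2,10,9,8], [3,4,19,18,16], [5,11,13,15,14], [6,7,20,17,12],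
     [1,6,7,8], [1,4,5,6], [4,5,14,19], [7,8,14,19], [8,9,15,14],
     [1,2,3,4], [19,7,20,18], [2,10,13,11], [2,3,12,11], [3,16,17,12],
     [10,16,18,13], [16,10,9,17], [11,12,6,5], [18,20,15,13], [17,9,15,20]})"

definition K3 :: "nat set \<times> nat list set" where
  "K3 = ({1..20},
    {[1,2,10,9,8], [3,4,19,17,16], [5,11,13,15,14], [6,7,20,18,12],
     [1,6,7,8], [1,4,5,6], [4,5,14,19], [7,8,14,19], [8,9,15,14],
     [1,2,3,4], [19,7,20,17], [2,10,13,11], [2,3,12,11], [3,16,18,12],
     [10,16,18,13], [16,10,9,17], [11,12,6,5], [18,20,15,13], [17,9,15,20]})"

end

(* Counting incidences gives 20 vertices and 19 faces, four of them pentagons, and the pentagons partition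
   the vertices. Call a pentagon edge straight if the quadrilateral on it joins it to another pentagon edge.
   At every vertex one of the two pentagon edges is straight, because otherwise the third quadrilateral at
   the vertex would meet a pentagon in a diagonal. A pentagon being an odd cycle, some vertex v has two
   straight pentagon edges. The third quadrilateral at v then meets all four pentagons, so that up to
   isomorphism the pentagons and four quadrilaterals are known. From this configuration a finite search,
   which only uses that two faces share at most an edge and that the faces at a vertex form a single
   cycle, leads to 27 complete maps, each isomorphic to one of the three. *)

theory Submission
  imports Defs
begin

section \<open>Vertex cycles\<close>

text \<open>Once every vertex is labelled by its pentagon and its place there, the pentagons are
  fixed and the map is a set of fifteen quadrilaterals of labels. A corner with two straight edges
  makes a good start because its third quadrilateral has no pentagon edge, and opposite corners of a
  quadrilateral never share a pentagon. So its corners lie in four different pentagons, which are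
  all there are, and the neighbouring quadrilaterals fix a starting point and a direction on each of
  them.

  The topology survives only as local rules on labels: a diagonal of one face is neither an edge nor
  a diagonal of another, and three quadrilaterals follow each other around a vertex beside its
  pentagon. The case analysis is a tree that records where to branch but not the cases; these are
  recomputed when the tree is checked, so their completeness does not rest on how the tree was
  found.\<close>

lemma cycle_edges_conv: "cycle_edges vs = (\<lambda>i. {vs ! i, vs ! (Suc i mod length vs)}) ` {..<length vs}"
  unfolding cycle_edges_def by auto

lemma Union_cycle_edges: "\<Union>(cycle_edges vs) = set vs"
proof -
  have "Suc i mod length vs < length vs" if "i < length vs" for i
    using that by (intro mod_less_divisor) auto
  then show ?thesis unfolding cycle_edges_conv by (auto simp: set_conv_nth)
qed

lemma cycle_edges_map: "cycle_edges (map f vs) = image f ` cycle_edges vs"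
proof -
  have "Suc i mod length vs < length vs" if "i < length vs" for i
    using that by (intro mod_less_divisor) auto
  then show ?thesis unfolding cycle_edges_conv by (auto simp: image_iff)
qed

lemma card_cycle_edges:
  assumes "distinct vs" "3 \<le> length vs"
  shows "card (cycle_edges vs) = length vs"
proof -
  let ?n = "length vs"
  have "inj_on (\<lambda>i. {vs ! i, vs ! (Suc i mod ?n)}) {..<?n}"
  proof (rule inj_onI)
    fix i j assume ij: "i \<in> {..<?n}" "j \<in> {..<?n}"
      and eq: "{vs ! i, vs ! (Suc i mod ?n)} = {vs ! j, vs ! (Suc j mod ?n)}"
    have s: "Suc i mod ?n < ?n" "Suc j mod ?n < ?n"
      using assms by (auto intro!: mod_less_divisor)
    show "i = j"
    proof (rule ccontr)
      assume "i \<noteq> j"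
      \<comment> \<open>Different positions with the same pair would each follow the other, which
        needs a cycle of length at most two.\<close>
      then have "i = Suc j mod ?n" "j = Suc i mod ?n"
        using eq ij s assms(1) by (auto simp: doubleton_eq_iff nth_eq_iff_index_eq)
      moreover have "Suc k mod ?n = (if Suc k = ?n then 0 else Suc k)" if "k < ?n" for k
        using that by auto
      ultimately show False using ij assms(2) by (auto split: if_splits)
    qed
  qed
  then show ?thesis unfolding cycle_edges_conv by (simp add: card_image)
qed

lemma cycle_edges4: "cycle_edges [a, b, c, d] = {{a, b}, {b, c}, {c, d}, {d, a}}"
proof -
  have "{..<length [a, b, c, d]} = {0, 1, 2, 3}" by auto
  then show ?thesis unfolding cycle_edges_conv by simp
qed

lemma cycle_edges5: "cycle_edges [a, b, c, d, e] = {{a, b}, {b, c}, {c, d}, {d, e}, {e, a}}"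
proof -
  have "{..<length [a, b, c, d, e]} = {0, 1, 2, 3, 4}" by auto
  then show ?thesis unfolding cycle_edges_conv by simp
qed

lemma length4_conv: "length vs = 4 \<longleftrightarrow> (\<exists>a b c d. vs = [a, b, c, d])"
  by (auto simp: numeral_eq_Suc length_Suc_conv)

lemma length5_conv: "length vs = 5 \<longleftrightarrow> (\<exists>a b c d e. vs = [a, b, c, d, e])"
  by (auto simp: numeral_eq_Suc length_Suc_conv)

lemma cycle_edges_rotate4: "cycle_edges [b, c, d, a] = cycle_edges [a, b, c, d]"
  unfolding cycle_edges4 by (simp add: insert_commute)

lemma cycle_edges_flip4: "cycle_edges [a, d, c, b] = cycle_edges [a, b, c, d]"
  unfolding cycle_edges4 by (simp add: insert_commute)

lemma cycle_edges_rotate5: "cycle_edges [b, c, d, e, a] = cycle_edges [a, b, c, d, e]"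
  unfolding cycle_edges5 by (simp add: insert_commute)

lemma cycle_edges_flip5: "cycle_edges [a, e, d, c, b] = cycle_edges [a, b, c, d, e]"
  unfolding cycle_edges5 by (simp add: insert_commute)

lemma rotate_to4:
  assumes "length vs = 4" "distinct vs" "v \<in> set vs"
  obtains b c d where "cycle_edges [v, b, c, d] = cycle_edges vs" "distinct [v, b, c, d]"
proof -
  obtain a b c d where vs: "vs = [a, b, c, d]" using assms(1) length4_conv by metis
  have "v \<in> {a, b, c, d}" using assms(3) vs by auto
  then consider "v = a" | "v = b" | "v = c" | "v = d" by blast
  then show thesis
    using that[of b c d] that[of c d a] that[of d a b] that[of a b c] assms(2)
    by cases (auto simp: vs cycle_edges_rotate4)
qed

lemma rotate_to5:
  assumes "length vs = 5" "distinct vs" "v \<in> set vs"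
  obtains b c d e where "cycle_edges [v, b, c, d, e] = cycle_edges vs" "distinct [v, b, c, d, e]"
proof -
  obtain a b c d e where vs: "vs = [a, b, c, d, e]" using assms(1) length5_conv by metis
  have "v \<in> {a, b, c, d, e}" using assms(3) vs by auto
  then consider "v = a" | "v = b" | "v = c" | "v = d" | "v = e" by blast
  then show thesis
    using that[of b c d e] that[of c d e a] that[of d e a b] that[of e a b c] that[of a b c d] assms(2)
    by cases (auto simp: vs cycle_edges_rotate5)
qed

lemma nbrs4: "distinct [v, b, c, d] \<Longrightarrow> {v, p} \<in> cycle_edges [v, b, c, d] \<longleftrightarrow> p = b \<or> p = d"
  unfolding cycle_edges4 by (auto simp: doubleton_eq_iff)

lemma nbrs5: "distinct [v, b, c, d, e] \<Longrightarrow> {v, p} \<in> cycle_edges [v, b, c, d, e] \<longleftrightarrow> p = b \<or> p = e"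
  unfolding cycle_edges5 by (auto simp: doubleton_eq_iff)

text \<open>Both neighbours of \<open>v\<close> on the cycle are given, so only the direction of
  reading is open, and a reversal settles it.\<close>

lemma corner4:
  assumes "length vs = 4" "distinct vs" "{v, p} \<in> cycle_edges vs" "{v, q} \<in> cycle_edges vs" "p \<noteq> q"
  shows "\<exists>u. cycle_edges [v, p, u, q] = cycle_edges vs \<and> distinct [v, p, u, q]"
proof -
  have "v \<in> set vs" using assms(3) Union_cycle_edges[of vs] by auto
  then obtain b c d where *: "cycle_edges [v, b, c, d] = cycle_edges vs" "distinct [v, b, c, d]"
    using rotate_to4[OF assms(1,2)] by blast
  have "p = b \<or> p = d" "q = b \<or> q = d" using assms(3,4) nbrs4[OF *(2)] unfolding *(1) by auto
  then consider "p = b" "q = d" | "p = d" "q = b" using assms(5) by blast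
  then show ?thesis
  proof cases
    case 1
    then show ?thesis using * by blast
  next
    case 2
    have "cycle_edges [v, d, c, b] = cycle_edges vs" using *(1) cycle_edges_flip4 by metis
    moreover have "distinct [v, d, c, b]" using *(2) by auto
    ultimately show ?thesis using 2 by blast
  qed
qed

lemma corner5:
  assumes "length vs = 5" "distinct vs" "{v, p} \<in> cycle_edges vs" "{v, q} \<in> cycle_edges vs" "p \<noteq> q"
  shows "\<exists>r s. cycle_edges [v, p, r, s, q] = cycle_edges vs \<and> distinct [v, p, r, s, q]"
proof -
  have "v \<in> set vs" using assms(3) Union_cycle_edges[of vs] by auto
  then obtain b c d e where *: "cycle_edges [v, b, c, d, e] = cycle_edges vs" "distinct [v, b, c, d, e]"
    using rotate_to5[OF assms(1,2)] by blast
  have "p = b \<or> p = e" "q = b \<or> q = e" using assms(3,4) nbrs5[OF *(2)] unfolding *(1) by auto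
  then consider "p = b" "q = e" | "p = e" "q = b" using assms(5) by blast
  then show ?thesis
  proof cases
    case 1
    then show ?thesis using * by blast
  next
    case 2
    have "cycle_edges [v, e, d, c, b] = cycle_edges vs" using *(1) cycle_edges_flip5 by metis
    moreover have "distinct [v, e, d, c, b]" using *(2) by auto
    ultimately show ?thesis using 2 by blast
  qed
qed

section \<open>A certified search over labelled quadrilaterals\<close>

datatype label =
    A0 | A1 | A2 | A3 | A4 | B0 | B1 | B2 | B3 | B4
  | C0 | C1 | C2 | C3 | C4 | D0 | D1 | D2 | D3 | D4

text \<open>The letter of a label names its pentagon, the digit its place there. Explicit tables
  reduce every test on labels to rewriting of constructors.\<close>

fun pent :: "label \<Rightarrow> label list" where
  "pent A0 = [A0, A1, A2, A3, A4]"
| "pent A1 = [A1, A2, A3, A4, A0]"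
| "pent A2 = [A2, A3, A4, A0, A1]"
| "pent A3 = [A3, A4, A0, A1, A2]"
| "pent A4 = [A4, A0, A1, A2, A3]"
| "pent B0 = [B0, B1, B2, B3, B4]"
| "pent B1 = [B1, B2, B3, B4, B0]"
| "pent B2 = [B2, B3, B4, B0, B1]"
| "pent B3 = [B3, B4, B0, B1, B2]"
| "pent B4 = [B4, B0, B1, B2, B3]"
| "pent C0 = [C0, C1, C2, C3, C4]"
| "pent C1 = [C1, C2, C3, C4, C0]"
| "pent C2 = [C2, C3, C4, C0, C1]"
| "pent C3 = [C3, C4, C0, C1, C2]"
| "pent C4 = [C4, C0, C1, C2, C3]"
| "pent D0 = [D0, D1, D2, D3, D4]"
| "pent D1 = [D1, D2, D3, D4, D0]"
| "pent D2 = [D2, D3, D4, D0, D1]"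
| "pent D3 = [D3, D4, D0, D1, D2]"
| "pent D4 = [D4, D0, D1, D2, D3]"

fun nxt :: "label \<Rightarrow> label" where
  "nxt A0 = A1"
| "nxt A1 = A2"
| "nxt A2 = A3"
| "nxt A3 = A4"
| "nxt A4 = A0"
| "nxt B0 = B1"
| "nxt B1 = B2"
| "nxt B2 = B3"
| "nxt B3 = B4"
| "nxt B4 = B0"
| "nxt C0 = C1"
| "nxt C1 = C2"
| "nxt C2 = C3"
| "nxt C3 = C4"
| "nxt C4 = C0"
| "nxt D0 = D1"
| "nxt D1 = D2"
| "nxt D2 = D3"
| "nxt D3 = D4"
| "nxt D4 = D0"

fun prv :: "label \<Rightarrow> label" where
  "prv A0 = A4"
| "prv A1 = A0"
| "prv A2 = A1"
| "prv A3 = A2"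
| "prv A4 = A3"
| "prv B0 = B4"
| "prv B1 = B0"
| "prv B2 = B1"
| "prv B3 = B2"
| "prv B4 = B3"
| "prv C0 = C4"
| "prv C1 = C0"
| "prv C2 = C1"
| "prv C3 = C2"
| "prv C4 = C3"
| "prv D0 = D4"
| "prv D1 = D0"
| "prv D2 = D1"
| "prv D3 = D2"
| "prv D4 = D3"

fun pent_diag :: "label \<Rightarrow> label list" where
  "pent_diag A0 = [A2, A3]"
| "pent_diag A1 = [A3, A4]"
| "pent_diag A2 = [A4, A0]"
| "pent_diag A3 = [A0, A1]"
| "pent_diag A4 = [A1, A2]"
| "pent_diag B0 = [B2, B3]"
| "pent_diag B1 = [B3, B4]"
| "pent_diag B2 = [B4, B0]"
| "pent_diag B3 = [B0, B1]"
| "pent_diag B4 = [B1, B2]"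
| "pent_diag C0 = [C2, C3]"
| "pent_diag C1 = [C3, C4]"
| "pent_diag C2 = [C4, C0]"
| "pent_diag C3 = [C0, C1]"
| "pent_diag C4 = [C1, C2]"
| "pent_diag D0 = [D2, D3]"
| "pent_diag D1 = [D3, D4]"
| "pent_diag D2 = [D4, D0]"
| "pent_diag D3 = [D0, D1]"
| "pent_diag D4 = [D1, D2]"

fun outside :: "label \<Rightarrow> label list" where
  "outside A0 = [B0, B1, B2, B3, B4, C0, C1, C2, C3, C4, D0, D1, D2, D3, D4]"
| "outside A1 = [B0, B1, B2, B3, B4, C0, C1, C2, C3, C4, D0, D1, D2, D3, D4]"
| "outside A2 = [B0, B1, B2, B3, B4, C0, C1, C2, C3, C4, D0, D1, D2, D3, D4]"
| "outside A3 = [B0, B1, B2, B3, B4, C0, C1, C2, C3, C4, D0, D1, D2, D3, D4]"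
| "outside A4 = [B0, B1, B2, B3, B4, C0, C1, C2, C3, C4, D0, D1, D2, D3, D4]"
| "outside B0 = [A0, A1, A2, A3, A4, C0, C1, C2, C3, C4, D0, D1, D2, D3, D4]"
| "outside B1 = [A0, A1, A2, A3, A4, C0, C1, C2, C3, C4, D0, D1, D2, D3, D4]"
| "outside B2 = [A0, A1, A2, A3, A4, C0, C1, C2, C3, C4, D0, D1, D2, D3, D4]"
| "outside B3 = [A0, A1, A2, A3, A4, C0, C1, C2, C3, C4, D0, D1, D2, D3, D4]"
| "outside B4 = [A0, A1, A2, A3, A4, C0, C1, C2, C3, C4, D0, D1, D2, D3, D4]"
| "outside C0 = [A0, A1, A2, A3, A4, B0, B1, B2, B3, B4, D0, D1, D2, D3, D4]"
| "outside C1 = [A0, A1, A2, A3, A4, B0, B1, B2, B3, B4, D0, D1, D2, D3, D4]"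
| "outside C2 = [A0, A1, A2, A3, A4, B0, B1, B2, B3, B4, D0, D1, D2, D3, D4]"
| "outside C3 = [A0, A1, A2, A3, A4, B0, B1, B2, B3, B4, D0, D1, D2, D3, D4]"
| "outside C4 = [A0, A1, A2, A3, A4, B0, B1, B2, B3, B4, D0, D1, D2, D3, D4]"
| "outside D0 = [A0, A1, A2, A3, A4, B0, B1, B2, B3, B4, C0, C1, C2, C3, C4]"
| "outside D1 = [A0, A1, A2, A3, A4, B0, B1, B2, B3, B4, C0, C1, C2, C3, C4]"
| "outside D2 = [A0, A1, A2, A3, A4, B0, B1, B2, B3, B4, C0, C1, C2, C3, C4]"
| "outside D3 = [A0, A1, A2, A3, A4, B0, B1, B2, B3, B4, C0, C1, C2, C3, C4]"
| "outside D4 = [A0, A1, A2, A3, A4, B0, B1, B2, B3, B4, C0, C1, C2, C3, C4]"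

lemma UNIV_label: "UNIV = {A0, A1, A2, A3, A4, B0, B1, B2, B3, B4, C0, C1, C2, C3, C4, D0, D1, D2, D3, D4}"
  using label.exhaust by blast

lemma finite_label: "finite (UNIV :: label set)"
  unfolding UNIV_label by simp

lemma card_label: "card (UNIV :: label set) = 20"
  unfolding UNIV_label by simp

lemma nxt_prv: "nxt v \<noteq> v" "prv v \<noteq> v" "nxt v \<noteq> prv v" "prv v \<noteq> nxt v"
  "nxt (prv v) = v" "prv (nxt v) = v"
  by (cases v; simp)+

lemma set_pent: "set (pent v) = insert v (insert (nxt v) (insert (prv v) (set (pent_diag v))))"
  by (cases v) auto

lemma set_outside: "set (outside v) = - set (pent v)"
proof -
  have "w \<in> set (outside v) \<longleftrightarrow> w \<notin> set (pent v)" for w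
    by (cases v; cases w; simp)
  then show ?thesis by blast
qed

lemma pent_nxt: "set (pent (nxt v)) = set (pent v)"
  by (cases v) auto

lemma pent_prv: "set (pent (prv v)) = set (pent v)"
  by (cases v) auto

section \<open>Partial maps as lists of known quadrilaterals\<close>

type_synonym quad = "label \<times> label \<times> label \<times> label"

fun adj :: "label \<Rightarrow> quad \<Rightarrow> label list" where
  "adj v (a, b, c, d) =
    (if v = a then [d, b] else if v = b then [a, c] else if v = c then [b, d]
     else if v = d then [c, a] else [])"

fun opp :: "label \<Rightarrow> quad \<Rightarrow> label list" where
  "opp v (a, b, c, d) =
    (if v = a then [c] else if v = b then [d] else if v = c then [a]
     else if v = d then [b] else [])"

fun remove :: "label list \<Rightarrow> label list \<Rightarrow> label list" where
  "remove ys [] = []"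
| "remove ys (x # xs) = (if x \<in> set ys then remove ys xs else x # remove ys xs)"

lemma set_remove [simp]: "set (remove ys xs) = set xs - set ys"
  by (induction xs) auto

lemma remove_id: "set xs \<inter> set ys = {} \<Longrightarrow> remove ys xs = xs"
  by (induction xs) auto

text \<open>For a genuine quadrilateral through the edge \<open>v w\<close>, the single entry is the
  other neighbour of \<open>v\<close> on it. An empty list means that \<open>q\<close> says nothing
  about this edge, so concatenation over \<open>Q\<close> collects what is known.\<close>

definition side :: "label \<Rightarrow> label \<Rightarrow> quad \<Rightarrow> label list" where
  "side v w q = (if w \<in> set (adj v q) then remove [w] (adj v q) else [])"

definition outer :: "label \<Rightarrow> quad \<Rightarrow> label list" where
  "outer v q = remove [nxt v, prv v] (adj v q)"

text \<open>Pentagon diagonals count along with those of quadrilaterals: in both cases the two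
  vertices share a face without being joined on it, so they cannot be an edge of another
  face.\<close>

definition diags :: "quad list \<Rightarrow> label \<Rightarrow> label list" where
  "diags Q v = pent_diag v @ concat (map (opp v) Q)"

definition nbrs :: "quad list \<Rightarrow> label \<Rightarrow> label list" where
  "nbrs Q v = nxt v # prv v # concat (map (adj v) Q)"

fun at_most_two :: "label list \<Rightarrow> bool" where
  "at_most_two (x # y # z # xs) = False"
| "at_most_two xs = True"

lemma at_most_two_length: "length xs \<le> 2 \<Longrightarrow> at_most_two xs"
  by (cases xs rule: at_most_two.cases) auto

text \<open>A vertex has only two neighbours outside its pentagon, and the quadrilaterals on its two pentagon
  edges lead to different ones.\<close>

definition ok_at :: "quad list \<Rightarrow> label \<Rightarrow> bool" where
  "ok_at Q v \<longleftrightarrow>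
    at_most_two (remdups (concat (map (outer v) Q))) \<and>
    remove (concat (map (side v (prv v)) Q)) (concat (map (side v (nxt v)) Q)) =
      concat (map (side v (nxt v)) Q)"

text \<open>Two known outer neighbours are all that a vertex has, so they replace the default list
  of candidates.\<close>

fun base :: "label list \<Rightarrow> label list \<Rightarrow> label list" where
  "base [x, y] ys = [x, y]"
| "base xs ys = ys"

lemma base_cases: "base xs ys = ys \<or> (\<exists>x y. xs = [x, y])"
  by (cases "(xs, ys)" rule: base.cases) auto

text \<open>The possible \<open>x\<close> in a quadrilateral \<open>(a, b, y, x)\<close> on the pentagon edge \<open>ab\<close>, where \<open>c\<close> is the
  other neighbour of \<open>a\<close> in its pentagon.\<close>

definition ends :: "quad list \<Rightarrow> label \<Rightarrow> label \<Rightarrow> label \<Rightarrow> label list" where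
  "ends Q a b c =
    remove (diags Q a @ diags Q b @ nbrs Q b @ concat (map (side a c) Q))
      (base (remdups (concat (map (outer a) Q))) (outside a))"

text \<open>First-order recursion instead of list comprehensions: \<open>code_simp\<close> also rewrites under abstractions,
  where the unevaluated candidates make the terms explode.\<close>

fun side_quads1 :: "quad list \<Rightarrow> label \<Rightarrow> label \<Rightarrow> label \<Rightarrow> label list \<Rightarrow> quad list" where
  "side_quads1 Q a b x [] = []"
| "side_quads1 Q a b x (y # ys) =
    (if ok_at ((a, b, y, x) # Q) x \<and> ok_at ((a, b, y, x) # Q) y
     then (a, b, y, x) # side_quads1 Q a b x ys else side_quads1 Q a b x ys)"

fun side_quads :: "quad list \<Rightarrow> label \<Rightarrow> label \<Rightarrow> label list \<Rightarrow> label list \<Rightarrow> quad list" where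
  "side_quads Q a b [] ys = []"
| "side_quads Q a b (x # xs) ys =
    side_quads1 Q a b x (remove (x # diags Q x) ys) @ side_quads Q a b xs ys"

fun opp_quads1 :: "quad list \<Rightarrow> label \<Rightarrow> label \<Rightarrow> label \<Rightarrow> label list \<Rightarrow> quad list" where
  "opp_quads1 Q v x y [] = []"
| "opp_quads1 Q v x y (u # us) =
    (if ok_at ((v, x, u, y) # Q) x \<and> ok_at ((v, x, u, y) # Q) y \<and> ok_at ((v, x, u, y) # Q) u
     then (v, x, u, y) # opp_quads1 Q v x y us else opp_quads1 Q v x y us)"

definition opp_quads :: "quad list \<Rightarrow> label \<Rightarrow> label \<Rightarrow> label \<Rightarrow> quad list" where
  "opp_quads Q v x y =
    (if x \<in> set (diags Q y @ nbrs Q y) then []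
     else opp_quads1 Q v x y (remove (diags Q x @ diags Q y @ diags Q v @ nbrs Q v) (outside v)))"

text \<open>Every known quadrilateral at \<open>v\<close> uses one of its pentagon edges, so the
  third one is still to be chosen.\<close>

fun opp_free :: "quad list \<Rightarrow> label \<Rightarrow> bool" where
  "opp_free [] v = True"
| "opp_free (q # Q) v =
    ((adj v q = [] \<or> nxt v \<in> set (adj v q) \<or> prv v \<in> set (adj v q)) \<and> opp_free Q v)"

text \<open>As \<open>pent a\<close> starts at \<open>a\<close>, a 5-gon has to be compared in two
  directions only. A quadrilateral is determined by the corner opposite to \<open>a\<close> and the
  two corners next to it.\<close>

fun label_face :: "quad list \<Rightarrow> label list \<Rightarrow> bool" where
  "label_face Q [a, b, c, d] =
    list_ex (\<lambda>q. opp a q = [c] \<and> (adj a q = [b, d] \<or> adj a q = [d, b])) Q"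
| "label_face Q [a, b, c, d, e] = (pent a = [a, b, c, d, e] \<or> pent a = [a, e, d, c, b])"
| "label_face Q _ = False"

text \<open>The listed maps number their vertices from 1, list positions start at 0.\<close>

definition lookup :: "label list \<Rightarrow> nat \<Rightarrow> label" where
  "lookup p n = p ! (n - 1)"

text \<open>Only one inclusion between the face sets is tested; the other one will follow from the
  number of faces.\<close>

definition realizes :: "quad list \<Rightarrow> label list \<Rightarrow> nat set \<times> nat list set \<Rightarrow> bool" where
  "realizes Q p K \<longleftrightarrow> (\<forall>vs\<in>snd K. label_face Q (map (lookup p) vs))"

text \<open>\<open>Side a\<close> branches over the quadrilaterals on the pentagon edge from \<open>a\<close> to \<open>nxt a\<close>, and
  \<open>Opp v x y\<close> over those at \<open>v\<close> that avoid its pentagon edges, where \<open>x\<close> and \<open>y\<close> are the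
  neighbours of \<open>v\<close> already found next to \<open>nxt v\<close> and \<open>prv v\<close>. A leaf lists the labels of the
  vertices \<open>1, \<dots>, 20\<close> of one of the three maps.\<close>

datatype cert =
    Side label "cert list"
  | Opp label label label "cert list"
  | Leaf "label list"

text \<open>Subtrees are matched in order with the recomputed candidates, and a list of the wrong
  length is rejected. An empty list of subtrees therefore asserts that no candidate is left, and
  nothing in the tree has to be trusted.\<close>

fun search :: "quad list \<Rightarrow> cert \<Rightarrow> bool"
  and search_all :: "quad list \<Rightarrow> quad list \<Rightarrow> cert list \<Rightarrow> bool" where
  "search Q (Side a ts) \<longleftrightarrow>
    concat (map (side a (nxt a)) Q) = [] \<and>
    search_all Q (side_quads Q a (nxt a) (ends Q a (nxt a) (prv a))
      (ends Q (nxt a) a (nxt (nxt a)))) ts"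
| "search Q (Opp v x y ts) \<longleftrightarrow>
    opp_free Q v \<and> x \<in> set (concat (map (side v (nxt v)) Q)) \<and>
    y \<in> set (concat (map (side v (prv v)) Q)) \<and> search_all Q (opp_quads Q v x y) ts"
| "search Q (Leaf p) \<longleftrightarrow>
    length p = 20 \<and> distinct p \<and> (realizes Q p K1 \<or> realizes Q p K2 \<or> realizes Q p K3)"
| "search_all Q [] [] \<longleftrightarrow> True"
| "search_all Q (q # qs) (t # ts) \<longleftrightarrow> search (q # Q) t \<and> search_all Q qs ts"
| "search_all Q _ _ \<longleftrightarrow> False"

section \<open>Soundness of the search\<close>

locale quad_labelling =
  fixes face4 :: "quad \<Rightarrow> bool"
  assumes rot: "face4 (a, b, c, d) \<Longrightarrow> face4 (b, c, d, a)"
    and flip: "face4 (a, b, c, d) \<Longrightarrow> face4 (a, d, c, b)"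
    and dist: "face4 (a, b, c, d) \<Longrightarrow> distinct [a, b, c, d]"
    and edge_pent: "face4 (a, b, c, d) \<Longrightarrow> b \<notin> set (pent_diag a)"
    and diag_pent: "face4 (a, b, c, d) \<Longrightarrow> c \<notin> set (pent a)"
    and diag_edge: "face4 (a, b, c, d) \<Longrightarrow> face4 (a, b', c', d') \<Longrightarrow> c \<noteq> b'"
    and diag_diag: "face4 (a, b, c, d) \<Longrightarrow> face4 (a, b', c, d') \<Longrightarrow> {b, d} = {b', d'}"
    and around: "\<exists>x y u1 u2 u3. x \<noteq> y \<and> x \<notin> {nxt v, prv v} \<and> y \<notin> {nxt v, prv v} \<and>
      face4 (v, nxt v, u1, x) \<and> face4 (v, x, u2, y) \<and> face4 (v, y, u3, prv v) \<and>
      (\<forall>b c d. face4 (v, b, c, d) \<longrightarrow> {b, d} \<in> {{nxt v, x}, {x, y}, {y, prv v}})"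
begin

lemma adj_face:
  assumes "face4 q" "w \<in> set (adj v q)"
  obtains c d where "face4 (v, w, c, d)" "opp v q = [c]" "adj v q = [w, d] \<or> adj v q = [d, w]"
proof -
  obtain a b c d where q: "q = (a, b, c, d)" by (cases q)
  note f = assms(1)[unfolded q]
  have fs: "face4 (a, b, c, d)" "face4 (b, c, d, a)" "face4 (c, d, a, b)" "face4 (d, a, b, c)"
    "face4 (a, d, c, b)" "face4 (b, a, d, c)" "face4 (c, b, a, d)" "face4 (d, c, b, a)"
    using f rot flip by metis+
  show ?thesis
    using assms(2) that fs dist[OF f] unfolding q by (auto split: if_splits)
qed

lemma opp_face:
  assumes "face4 q" "w \<in> set (opp v q)"
  obtains b d where "face4 (v, b, w, d)" "adj v q = [b, d]"
proof -
  obtain a b c d where q: "q = (a, b, c, d)" by (cases q)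
  note f = assms(1)[unfolded q]
  have fs: "face4 (a, b, c, d)" "face4 (b, c, d, a)" "face4 (c, d, a, b)" "face4 (d, a, b, c)"
    "face4 (a, d, c, b)" "face4 (b, a, d, c)" "face4 (c, b, a, d)" "face4 (d, c, b, a)"
    using f rot flip by metis+
  show ?thesis
    using assms(2) that fs dist[OF f] unfolding q by (auto split: if_splits)
qed

lemma adj_sym:
  assumes "face4 q" "w \<in> set (adj v q)"
  shows "v \<in> set (adj w q)"
  using assms dist by (cases q) (auto split: if_splits)

lemma flip': "face4 (a, b, c, d) \<Longrightarrow> face4 (b, a, d, c)"
  using rot flip by metis

lemma adj_cases:
  assumes "face4 q" "adj v q \<noteq> []"
  obtains b d c where "face4 (v, b, c, d)" "adj v q = [b, d]"
proof -
  have "opp v q \<noteq> []" using assms(2) by (cases q) (auto split: if_splits)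
  then obtain w where "w \<in> set (opp v q)" by (cases "opp v q") auto
  then show ?thesis using opp_face[OF assms(1)] that by metis
qed

text \<open>In the cyclic order at \<open>v\<close>, \<open>x\<close> is the outer neighbour
  attached to \<open>nxt v\<close> and \<open>y\<close> the one attached to \<open>prv v\<close>. A
  quadrilateral at \<open>v\<close> shows two consecutive neighbours, which limits what
  \<open>outer\<close> and \<open>side\<close> can return.\<close>

lemma around_adj:
  obtains x y where "x \<noteq> y" "x \<notin> {nxt v, prv v}" "y \<notin> {nxt v, prv v}"
    "\<exists>u. face4 (v, nxt v, u, x)" "\<exists>u. face4 (v, x, u, y)" "\<exists>u. face4 (v, y, u, prv v)"
    "\<And>b c d. face4 (v, b, c, d) \<Longrightarrow> {b, d} \<in> {{nxt v, x}, {x, y}, {y, prv v}}"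
    "\<And>q. face4 q \<Longrightarrow> set (outer v q) \<subseteq> {x, y}"
    "\<And>q. face4 q \<Longrightarrow> set (side v (nxt v) q) \<subseteq> {x}"
    "\<And>q. face4 q \<Longrightarrow> set (side v (prv v) q) \<subseteq> {y}"
proof -
  obtain x y where xy: "x \<noteq> y" "x \<notin> {nxt v, prv v}" "y \<notin> {nxt v, prv v}"
    "\<exists>u. face4 (v, nxt v, u, x)" "\<exists>u. face4 (v, x, u, y)" "\<exists>u. face4 (v, y, u, prv v)"
    "\<And>b c d. face4 (v, b, c, d) \<Longrightarrow> {b, d} \<in> {{nxt v, x}, {x, y}, {y, prv v}}"
    using around[of v] by blast
  have a: "adj v q = [] \<or> (\<exists>b d. adj v q = [b, d] \<and> {b, d} \<in> {{nxt v, x}, {x, y}, {y, prv v}})"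
    if "face4 q" for q
  proof (cases "adj v q = []")
    case False
    then obtain b d c where "face4 (v, b, c, d)" "adj v q = [b, d]"
      using adj_cases \<open>face4 q\<close> by metis
    then show ?thesis using xy(7) by blast
  qed simp
  have 1: "set (outer v q) \<subseteq> {x, y}" if "face4 q" for q
    using a[OF that] xy(1-3) unfolding outer_def by (auto simp: doubleton_eq_iff)
  have 2: "set (side v (nxt v) q) \<subseteq> {x}" if "face4 q" for q
    using a[OF that] xy(1-3) nxt_prv[of v] unfolding side_def by (auto simp: doubleton_eq_iff)
  have 3: "set (side v (prv v) q) \<subseteq> {y}" if "face4 q" for q
    using a[OF that] xy(1-3) nxt_prv[of v] unfolding side_def by (auto simp: doubleton_eq_iff)
  show thesis using that[OF xy(1-6)] xy(7) 1 2 3 by blast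
qed

text \<open>The two outer neighbours of \<open>v\<close> belong to different pentagon edges. Hence
  the test is a necessary condition on true faces, and pruning by it loses none of them.\<close>

lemma ok_at_faces:
  assumes "\<And>q. q \<in> set Q \<Longrightarrow> face4 q"
  shows "ok_at Q v"
proof -
  obtain x y where xy: "x \<noteq> y" 
    "\<And>q. face4 q \<Longrightarrow> set (outer v q) \<subseteq> {x, y}"
    "\<And>q. face4 q \<Longrightarrow> set (side v (nxt v) q) \<subseteq> {x}"
    "\<And>q. face4 q \<Longrightarrow> set (side v (prv v) q) \<subseteq> {y}"
    using around_adj by metis
  let ?l = "remdups (concat (map (outer v) Q))"
  have "set ?l \<subseteq> {x, y}" using xy(2) assms by fastforce
  then have "card (set ?l) \<le> card {x, y}" by (intro card_mono) auto
  then have "length ?l \<le> 2"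
    using distinct_card[of ?l] card_insert_le_m1[of 2 "{y}" x] by (simp add: card_insert_if split: if_splits)
  then have "at_most_two ?l" using at_most_two_length by blast
  moreover have "set (concat (map (side v (nxt v)) Q)) \<subseteq> {x}" using xy(3) assms by fastforce
  moreover have "set (concat (map (side v (prv v)) Q)) \<subseteq> {y}" using xy(4) assms by fastforce
  ultimately show ?thesis
    unfolding ok_at_def using xy(1) by (intro conjI remove_id) blast+
qed

text \<open>Each filter in \<open>ends\<close> reflects a rule. In the new face \<open>a x\<close>
  is an edge and \<open>b x\<close> a diagonal; edges and diagonals exclude each other across faces,
  two faces do not share a diagonal, and the two pentagon edges at \<open>a\<close> lead to
  different outer neighbours.\<close>

lemma ends_complete:
  assumes known: "\<And>q. q \<in> set Q \<Longrightarrow> face4 q"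
    and free: "\<And>q. q \<in> set Q \<Longrightarrow> b \<notin> set (adj a q)"
    and bc: "b = nxt a \<and> c = prv a \<or> b = prv a \<and> c = nxt a"
    and new: "face4 (a, b, u, x)"
  shows "x \<in> set (ends Q a b c)"
proof -
  obtain x0 y0 where xy: "x0 \<noteq> y0" "x0 \<notin> {nxt a, prv a}" "y0 \<notin> {nxt a, prv a}"
    "\<And>b c d. face4 (a, b, c, d) \<Longrightarrow> {b, d} \<in> {{nxt a, x0}, {x0, y0}, {y0, prv a}}"
    "\<And>q. face4 q \<Longrightarrow> set (outer a q) \<subseteq> {x0, y0}"
    by (rule around_adj[of a]) blast
  have bx: "{b, x} \<in> {{nxt a, x0}, {x0, y0}, {y0, prv a}}" using xy(4)[OF new] .
  have x0: "x \<in> {x0, y0}" using bx bc xy(1-3) nxt_prv[of a] by (auto simp: doubleton_eq_iff)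
  have D: "distinct [a, b, u, x]" using dist[OF new] .
  have new2: "face4 (b, a, x, u)" "face4 (a, x, u, b)" "face4 (b, u, x, a)"
    using new flip' flip rot by metis+
  have pent_b: "set (pent b) = set (pent a)" using bc pent_nxt pent_prv by auto
  have x_pent: "x \<notin> set (pent a)"
    using diag_pent[OF new2(3)] pent_b by simp
  have out: "x \<in> set (base (remdups (concat (map (outer a) Q))) (outside a))"
  proof (cases "\<exists>p r. remdups (concat (map (outer a) Q)) = [p, r]")
    case True
    then obtain p r where pr: "remdups (concat (map (outer a) Q)) = [p, r]" by blast
    have "p \<noteq> r" using pr by (metis distinct_length_2_or_more distinct_remdups)
    moreover have "{p, r} \<subseteq> {x0, y0}"
    proof -
      have "{p, r} = set (concat (map (outer a) Q))" using pr by (metis empty_set list.simps(15) set_remdups)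
      also have "\<dots> \<subseteq> {x0, y0}" using xy(5) known by fastforce
      finally show ?thesis .
    qed
    ultimately show ?thesis using pr x0 by auto
  next
    case False
    then have "base (remdups (concat (map (outer a) Q))) (outside a) = outside a"
      using base_cases by blast
    then show ?thesis using set_outside x_pent by simp
  qed
  have 1: "x \<notin> set (diags Q a)"
  proof
    assume "x \<in> set (diags Q a)"
    then consider "x \<in> set (pent_diag a)" | q where "q \<in> set Q" "x \<in> set (opp a q)"
      unfolding diags_def by auto
    then show False
    proof cases
      case 2
      then show False using opp_face known diag_edge new2(2) by metis
    qed (use x_pent set_pent in auto)
  qed
  have 2: "x \<notin> set (diags Q b)"
  proof
    assume "x \<in> set (diags Q b)"
    then consider "x \<in> set (pent_diag b)" | q where "q \<in> set Q" "x \<in> set (opp b q)"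
      unfolding diags_def by auto
    then show False
    proof cases
      case 2
      \<comment> \<open>A common diagonal \<open>b x\<close> makes \<open>q\<close> and the new face
        agree around \<open>b\<close>, so the edge \<open>a b\<close> would already lie on the known
        \<open>q\<close>.\<close>
      obtain p r where "face4 (b, p, x, r)" "adj b q = [p, r]" using opp_face known 2 by metis
      then have "a \<in> set (adj b q)" using diag_diag[OF new2(3)] by auto
      then show False using adj_sym known free 2 by blast
    qed (use x_pent pent_b set_pent in auto)
  qed
  have 3: "x \<notin> set (nbrs Q b)"
  proof
    assume "x \<in> set (nbrs Q b)"
    then consider "x \<in> {nxt b, prv b}" | q where "q \<in> set Q" "x \<in> set (adj b q)"
      unfolding nbrs_def by auto
    then show False
    proof cases
      case 2
      then show False using adj_face known diag_edge new2(3) by metis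
    qed (use x_pent pent_b set_pent[of b] in auto)
  qed
  have 4: "x \<notin> set (concat (map (side a c) Q))"
  proof
    assume "x \<in> set (concat (map (side a c) Q))"
    then obtain q where q: "q \<in> set Q" "c \<in> set (adj a q)" "x \<in> set (adj a q)" "x \<noteq> c"
      unfolding side_def by (auto split: if_splits)
    obtain p r where "face4 (a, c, p, r)" "adj a q = [c, r] \<or> adj a q = [r, c]"
      using adj_face[OF known[OF q(1)] q(2)] by metis
    then have "face4 (a, c, p, x)" using q by auto
    \<comment> \<open>The outer neighbour attached to \<open>c\<close> is not the one attached to
      \<open>b\<close>.\<close>
    then have "{c, x} \<in> {{nxt a, x0}, {x0, y0}, {y0, prv a}}" using xy(4) by blast
    then show False using bx bc xy(1-3) nxt_prv[of a] by (auto simp: doubleton_eq_iff)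
  qed
  show ?thesis unfolding ends_def using out 1 2 3 4 by simp
qed

lemma side_quads1_mem:
  assumes "y \<in> set ys" "ok_at ((a, b, y, x) # Q) x" "ok_at ((a, b, y, x) # Q) y"
  shows "(a, b, y, x) \<in> set (side_quads1 Q a b x ys)"
  using assms by (induction ys) auto

lemma side_quads_mem:
  assumes "x \<in> set xs" "y \<in> set ys" "y \<notin> set (x # diags Q x)"
    "ok_at ((a, b, y, x) # Q) x" "ok_at ((a, b, y, x) # Q) y"
  shows "(a, b, y, x) \<in> set (side_quads Q a b xs ys)"
  using assms by (induction xs) (auto intro: side_quads1_mem)

lemma opp_quads1_mem:
  assumes "u \<in> set us" "ok_at ((v, x, u, y) # Q) x" "ok_at ((v, x, u, y) # Q) y"
    "ok_at ((v, x, u, y) # Q) u"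
  shows "(v, x, u, y) \<in> set (opp_quads1 Q v x y us)"
  using assms by (induction us) auto

lemma edge_not_diag:
  assumes "\<And>q. q \<in> set Q \<Longrightarrow> face4 q" "face4 (a, b, c, d)"
  shows "b \<notin> set (diags Q a)"
proof
  assume "b \<in> set (diags Q a)"
  then consider "b \<in> set (pent_diag a)" | q where "q \<in> set Q" "b \<in> set (opp a q)"
    unfolding diags_def by auto
  then show False
    using opp_face assms diag_edge edge_pent by cases metis+
qed

lemma diag_not_nbr:
  assumes "\<And>q. q \<in> set Q \<Longrightarrow> face4 q" "face4 (a, b, c, d)"
  shows "c \<notin> set (nbrs Q a)"
proof
  assume "c \<in> set (nbrs Q a)"
  then consider "c \<in> {nxt a, prv a}" | q where "q \<in> set Q" "c \<in> set (adj a q)"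
    unfolding nbrs_def by auto
  then show False
  proof cases
    case 2
    then show False using adj_face assms diag_edge by metis
  qed (use diag_pent[OF assms(2)] set_pent[of a] in auto)
qed

text \<open>The map does have a quadrilateral on this pentagon edge. It passes all filters because
  each of them is a necessary condition on true faces.\<close>

lemma side_step:
  assumes known: "\<And>q. q \<in> set Q \<Longrightarrow> face4 q"
    and free: "concat (map (side a (nxt a)) Q) = []"
  shows "\<exists>q\<in>set (side_quads Q a (nxt a) (ends Q a (nxt a) (prv a))
    (ends Q (nxt a) a (nxt (nxt a)))). face4 q"
proof -
  obtain x u where new: "face4 (a, nxt a, u, x)"
    using around by blast
  have n1: "nxt a \<notin> set (adj a q)" if q: "q \<in> set Q" for q
  proof
    assume m: "nxt a \<in> set (adj a q)"
    obtain c d where cd: "face4 (a, nxt a, c, d)" "adj a q = [nxt a, d] \<or> adj a q = [d, nxt a]"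
      using adj_face[OF known[OF q] m] by metis
    have "d \<noteq> nxt a" using dist[OF cd(1)] by auto
    then have "side a (nxt a) q \<noteq> []" using cd(2) unfolding side_def by auto
    then show False using free q by auto
  qed
  have n2: "a \<notin> set (adj (nxt a) q)" if "q \<in> set Q" for q
    using n1 adj_sym known that by blast
  have new2: "face4 (nxt a, a, x, u)" "face4 (x, u, nxt a, a)" using new flip' flip rot by metis+
  have x: "x \<in> set (ends Q a (nxt a) (prv a))"
    using ends_complete known n1 new by blast
  have u: "u \<in> set (ends Q (nxt a) a (nxt (nxt a)))"
    by (rule ends_complete[OF known n2 _ new2(1)]) (auto simp: nxt_prv)
  have "u \<notin> set (x # diags Q x)"
    using edge_not_diag[OF known new2(2)] dist[OF new] by auto
  moreover have "ok_at ((a, nxt a, u, x) # Q) w" for w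
    by (rule ok_at_faces) (use known new in auto)
  ultimately show ?thesis using side_quads_mem[OF x u] new by blast
qed

lemma opp_step:
  assumes known: "\<And>q. q \<in> set Q \<Longrightarrow> face4 q"
    and free: "opp_free Q v"
    and x: "x \<in> set (concat (map (side v (nxt v)) Q))"
    and y: "y \<in> set (concat (map (side v (prv v)) Q))"
  shows "\<exists>q\<in>set (opp_quads Q v x y). face4 q"
proof -
  obtain x0 y0 where xy: "x0 \<noteq> y0" "x0 \<notin> {nxt v, prv v}" "y0 \<notin> {nxt v, prv v}"
    "\<exists>u. face4 (v, x0, u, y0)"
    "\<And>q. face4 q \<Longrightarrow> set (side v (nxt v) q) \<subseteq> {x0}"
    "\<And>q. face4 q \<Longrightarrow> set (side v (prv v) q) \<subseteq> {y0}"
    by (rule around_adj[of v]) blast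
  have "x = x0" "y = y0" using x y xy(5,6) known by fastforce+
  then obtain u where new: "face4 (v, x, u, y)" using xy(4) by blast
  have xy': "x \<notin> {nxt v, prv v}" "y \<notin> {nxt v, prv v}" using xy \<open>x = x0\<close> \<open>y = y0\<close> by auto
  have fr: "adj v q = [] \<or> nxt v \<in> set (adj v q) \<or> prv v \<in> set (adj v q)" if "q \<in> set Q" for q
    using free that by (induction Q) auto
  have no: "set (adj v q) \<noteq> {x, y}" if "q \<in> set Q" for q
    using fr[OF that] xy' by fastforce
  have new2: "face4 (x, u, y, v)" "face4 (y, v, x, u)" "face4 (y, u, x, v)"
    using new flip' flip rot by metis+
  have 1: "x \<notin> set (diags Q y)"
  proof
    assume "x \<in> set (diags Q y)"
    then consider "x \<in> set (pent_diag y)" | q where "q \<in> set Q" "x \<in> set (opp y q)"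
      unfolding diags_def by auto
    then show False
    proof cases
      case 2
      obtain p r where pr: "face4 (y, p, x, r)" "adj y q = [p, r]" using opp_face known 2 by metis
      \<comment> \<open>With the diagonal \<open>x y\<close> in common, \<open>q\<close> would have
        \<open>x\<close> and \<open>y\<close> as its neighbours of \<open>v\<close>, hence no
        pentagon edge of \<open>v\<close>, against \<open>opp_free\<close>.\<close>
      then have "v \<in> set (adj y q)" using diag_diag[OF new2(2)] by auto
      then have m: "y \<in> set (adj v q)" using adj_sym known 2 by blast
      obtain c d where cd: "face4 (v, y, c, d)" "adj v q = [y, d] \<or> adj v q = [d, y]"
        using adj_face[OF known[OF 2(1)] m] by metis
      have d: "d = nxt v \<or> d = prv v" using fr[OF 2(1)] cd(2) xy' by auto
      have "d \<in> set (adj v q)" using cd(2) by auto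
      then have "d = y \<or> d \<in> set (opp y q)"
        using m dist known[OF 2(1)] by (cases q) (auto split: if_splits)
      moreover have "d \<noteq> y" using xy' d by auto
      ultimately have "d = x" using 2(2) by (cases q) (auto split: if_splits)
      then show False using xy' d by auto
    qed (use diag_pent[OF new2(2)] set_pent in auto)
  qed
  have 2: "x \<notin> set (nbrs Q y)" using diag_not_nbr[OF known new2(2)] by blast
  have 3: "u \<notin> set (diags Q x)" using edge_not_diag[OF known new2(1)] by blast
  have 4: "u \<notin> set (diags Q y)" using edge_not_diag[OF known new2(3)] by blast
  have 5: "u \<notin> set (diags Q v)"
  proof
    assume "u \<in> set (diags Q v)"
    then consider "u \<in> set (pent_diag v)" | q where "q \<in> set Q" "u \<in> set (opp v q)"
      unfolding diags_def by auto
    then show False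
    proof cases
      case 2
      obtain p r where pr: "face4 (v, p, u, r)" "adj v q = [p, r]" using opp_face known 2 by metis
      then show False using diag_diag[OF new pr(1)] no[OF 2(1)] by auto
    qed (use diag_pent[OF new] set_pent in auto)
  qed
  have 6: "u \<notin> set (nbrs Q v)" using diag_not_nbr[OF known new] by blast
  have 7: "u \<in> set (outside v)" using diag_pent[OF new] set_outside by simp
  have ok: "ok_at ((v, x, u, y) # Q) w" for w
    by (rule ok_at_faces) (use known new in auto)
  have "(v, x, u, y) \<in> set (opp_quads Q v x y)"
    unfolding opp_quads_def using 1 2 3 4 5 6 7 ok by (auto intro!: opp_quads1_mem)
  then show ?thesis using new by blast
qed

definition face_word :: "label list \<Rightarrow> bool" where
  "face_word vs \<longleftrightarrow> (\<exists>a b c d. vs = [a, b, c, d] \<and> face4 (a, b, c, d)) \<or>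
     (\<exists>a b c d e. vs = [a, b, c, d, e] \<and> (pent a = [a, b, c, d, e] \<or> pent a = [a, e, d, c, b]))"

lemma label_face_word:
  assumes known: "\<And>q. q \<in> set Q \<Longrightarrow> face4 q" and "label_face Q vs"
  shows "face_word vs"
proof (cases "(Q, vs)" rule: label_face.cases)
  case (1 Q' a b c d)
  then obtain q where q: "q \<in> set Q" "opp a q = [c]" "adj a q = [b, d] \<or> adj a q = [d, b]"
    using assms(2) by (auto simp: list_ex_iff)
  obtain p r where "face4 (a, p, c, r)" "adj a q = [p, r]"
    using opp_face[OF known[OF q(1)]] q(2) by (metis list.set_intros(1))
  then have "face4 (a, b, c, d)" using q(3) flip by auto
  then show ?thesis using 1 unfolding face_word_def by blast
qed (use assms(2) in \<open>auto simp: face_word_def\<close>)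

definition realized :: "nat set \<times> nat list set \<Rightarrow> bool" where
  "realized K \<longleftrightarrow> (\<exists>p. length p = 20 \<and> distinct p \<and> (\<forall>vs\<in>snd K. face_word (map (lookup p) vs)))"

lemma realizes_realized:
  assumes "\<And>q. q \<in> set Q \<Longrightarrow> face4 q" "length p = 20" "distinct p" "realizes Q p K"
  shows "realized K"
  using assms label_face_word unfolding realized_def realizes_def by blast

text \<open>The second statement assumes that one of the candidates is a face. An empty list is then
  contradictory, and otherwise the subtree of that candidate applies.\<close>

lemma search_sound:
  shows "search Q t \<Longrightarrow> (\<forall>q\<in>set Q. face4 q) \<Longrightarrow> realized K1 \<or> realized K2 \<or> realized K3"
    and "search_all Q qs ts \<Longrightarrow> (\<forall>q\<in>set Q. face4 q) \<Longrightarrow> (\<exists>q\<in>set qs. face4 q) \<Longrightarrow>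
      realized K1 \<or> realized K2 \<or> realized K3"
proof (induction Q t and Q qs ts rule: search_search_all.induct)
  case (1 Q a ts)
  then show ?case using side_step[of Q a] by simp
next
  case (2 Q v x y ts)
  then show ?case using opp_step[of Q v x y] by simp
next
  case (3 Q p)
  then show ?case using realizes_realized[of Q p K1] realizes_realized[of Q p K2]
      realizes_realized[of Q p K3] by auto
next
  case (5 Q q qs t ts)
  then show ?case by auto
qed auto

end

section \<open>The search tree\<close>

text \<open>\<open>A1\<close> is the corner with two straight edges. The first entry is its third
  quadrilateral, the next two lie on the straight edges \<open>A0 A1\<close> and
  \<open>A1 A2\<close>, and the last one is the remaining quadrilateral at \<open>B1\<close>, on the
  edge \<open>B1 B2\<close>.\<close>

definition start :: "quad list" where
  "start = [(A1, B1, D0, C0), (A0, A1, B1, B0), (A1, A2, C1, C0), (B1, B2, D1, D0)]"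
text \<open>A node only names the place to branch; its subtrees follow the order in which
  \<open>side_quads\<close> or \<open>opp_quads\<close> lists the candidates.\<close>

definition certificate :: cert where
  "certificate =
  Side C4 [Side D1 [],Side A2 [Opp A2 B0 C1 [],Opp A2 B2 C1 [Side C1 [Side A3 [Opp A3 B0 B3 [],Opp
  A3 B4 B3 [],Opp A3 B4 B3 [],Opp A3 B4 B3 [],Opp A3 C2 B3 [Side B3 [Side A4 [Side C3 [],Opp A4 C4
  C3 [],Opp A0 B0 B4 [],Opp A0 B0 D4 [Opp A4 D3 C3 [Side B4 [Leaf [A0,A1,B1,B0,C4,D4,D3,A4,A3,A2,C0,
  D0,C1,C3,C2,B2,B3,D1,B4,D2]]]],Side B4 [],Opp A0 B0 D3 []]]],Opp A3 C2 B3 [Side B3 [Side C3 []]],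
  Opp A3 C3 B3 [Opp C2 B3 D2 [],Opp C4 D4 B3 []],Opp A3 C3 B3 [Opp C2 A4 D2 [Side A4 []]],Opp A3 C3
  B3 [Opp C4 D4 A4 [Side A4 []]],Opp A3 C3 B3 [Opp C2 B3 D2 [Side C3 []],Opp C4 D4 B3 [Side C2 []]],
  Opp A3 C4 B3 [Side B3 [Side A4 [Side C2 [],Opp A4 C2 C3 [],Side B4 [],Opp A0 B0 D3 [],Opp A0 B0
  B4 [],Opp A0 B0 D2 [Opp A4 D3 C3 [Side B4 [Leaf [A2,A1,C0,C1,D1,B2,B3,A3,A4,A0,B1,D0,B0,C4,C3,D2,
  D3,C2,D4,B4]]]]]]],Opp A3 C4 B3 [Side B3 [Side C2 []]],Opp A3 D2 B3 [Side B3 [Side C3 []]],Opp A3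
  D2 B3 [Side B3 [Side A4 [Side D3 [],Opp A0 B0 B4 [],Opp A0 B0 C4 [Opp A4 C3 D3 [Side B4 [Leaf [A4,
  A0,C4,C3,B4,D3,D2,A3,A2,A1,B0,D4,B1,B3,B2,C0,C1,D0,C2,D1]]]],Opp A0 B0 C3 [],Side B4 [],Opp A4 D4
  D3 []]]],Opp A3 D3 B3 [Opp D2 B3 C2 [],Opp D4 C4 B3 []],Opp A3 D3 B3 [Opp D2 B3 C2 [Side C3 []],
  Opp D4 C4 B3 [Side C2 []]],Opp A3 D3 B3 [Opp D2 A4 C2 [Side A4 []]],Opp A3 D3 B3 [Opp D4 C4 A4
  [Side A4 []]],Opp A3 D4 B3 [Side B3 [Side C2 []]],Opp A3 D4 B3 [Side B3 [Side A4 [Side D2 [],Opp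
  A0 B0 C3 [],Side B4 [],Opp A0 B0 B4 [],Opp A0 B0 C2 [Opp A4 C3 D3 [Side B4 [Leaf [A1,A2,C1,C0,D0,
  B1,B0,A0,A4,A3,B2,D1,B3,C2,C3,D4,D3,C4,D2,B4]]]],Opp A4 D2 D3 []]]]]]],Opp A2 B2 C1 [Side C1
  [Side B3 [Opp A0 B0 B4 [],Opp A3 B4 D1 [Side A4 [Side C3 []]]],Side B3 [Side D1 [Side A3 [Side A4
  [Side C3 [],Opp A4 C4 C3 [],Opp A0 B0 B4 [],Opp A0 B0 D4 [Opp A4 D3 C3 [Side B4 [Leaf [A0,A1,B1,
  B0,C4,D4,D3,A4,A3,A2,C0,D0,C1,C3,C2,B2,D1,B3,B4,D2]]]],Side B4 [],Opp A0 B0 D3 []]]]],Side B3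
  [Side D1 [Side D3 [Side B4 []]],Opp D4 C4 B4 [Side D2 []]]]],Opp A2 B3 C1 [Opp B2 A3 D1 [Side A3
  [Side B3 [Side C1 [Side A4 [Side C3 [],Opp A4 C4 C3 [],Opp A0 B0 B4 [],Opp A0 B0 D4 [Opp A4 D3 C3
  [Side B4 [Leaf [A2,A3,B2,B3,D2,C1,C0,A1,A0,A4,C2,D1,C3,B1,B0,D3,D4,B4,D0,C4]]]],Side B4 [],Opp A0
  B0 D3 []]]]],Side D1 []],Opp B2 A3 D1 [Side C1 [],Side A3 [Side C3 [Opp C4 D4 D2 []],Opp C4 D4 A4
  [Side A4 []]]]],Opp A2 B3 C1 [Side B2 [Opp B2 D3 D1 []],Side B2 [Opp B2 D2 D1 [],Opp B2 D4 D1
  []]],Opp A2 B3 C1 [Opp B2 C1 D1 [],Side B2 [Opp B2 C3 D1 [Side C1 [Side A3 []]]]],Opp A2 B3 C1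
  [Opp B2 C1 D1 [Side B3 [Opp C2 B4 D1 [Side B4 [Opp B0 A0 A4 []]],Opp C4 D4 B4 [Side D1 []]]],Side
  B2 [Opp B2 C2 D1 [Side C1 []],Opp B2 C4 D1 []]],Opp A2 B3 C1 [Opp B2 C1 D1 [Side B3 [Side D1
  [Side A3 [Side A4 [Side C3 [],Opp A4 C4 C3 [],Opp A0 B0 B4 [],Opp A0 B0 D4 [Opp A4 D3 C3 [Side B4
  [Leaf [A0,A4,D3,D4,C4,B0,B1,A1,A2,A3,C3,B4,C2,C0,C1,D2,B3,D1,D0,B2]]]],Side B4 [],Opp A0 B0 D3
  []]]]]],Side B2 [Opp B2 D3 D1 []]],Opp A2 B3 C1 [Opp B2 C1 D1 [Side B3 [Side D1 [Side D3 [Opp D4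
  C4 C3 []]],Opp D4 C4 B4 [Side D1 []]]],Side B2 [Opp B2 D2 D1 [],Opp B2 D4 D1 []]],Opp B0 A0 A3 [],
  Opp A2 B4 C1 [Side B4 [Opp B0 A0 D1 [],Side D1 [Opp B0 A0 D3 [Opp D1 C2 B2 [Side A3 []]]]],Side
  B4 [Side D3 [Opp D4 C4 C2 []],Opp B0 A0 D4 [Side A4 [Side C1 [Side A3 [Opp A3 B2 B3 [],Side B2 [],
  Side C2 [],Opp A3 D1 B3 [],Opp A4 C3 C2 [],Opp A3 D2 B3 [Opp A4 C3 D1 [Side B2 [Leaf [A1,A0,B0,B1,
  D0,C0,C1,A2,A3,A4,C4,D4,C3,B4,B3,D1,D2,B2,D3,C2]]]]]]]]]],Opp A2 B4 C1 [Opp B0 A0 C1 [],Side B4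
  [Side C1 [Side A3 [Opp B2 A4 D1 []]]]],Opp A2 B4 C1 [Opp B0 A0 C1 [Side B3 [Opp C2 B3 A0 [Side B2
  [Opp B2 D2 D1 [],Opp B2 D3 D1 []]],Opp C4 D4 B3 [Side A4 []]]],Side B4 [Opp B0 A0 C2 [Side C1 [],
  Side C1 []],Opp B0 A0 C4 [Side A4 [Side C1 [Side C2 []]]]]],Opp A2 B4 C1 [Opp B0 A0 C1 [Side A4
  [Side B3 [],Side D2 []]],Side B4 [Opp B0 A0 D1 [],Side C1 [Opp B0 A0 D3 [Side A4 []]]]],Opp A2 B4
  C1 [Opp B0 A0 C1 [Side A4 [Side B3 [],Side D2 []]],Side B4 [Side C1 [Opp B0 A0 D2 [Side A4 []]],
  Opp B0 A0 D4 [Side A4 [Side C1 [Side B2 []]]]]],Opp A2 C2 C1 [],Opp A2 C2 C1 [],Opp A2 C2 C1 [],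
  Opp A2 C2 C1 [],Opp A2 C2 C1 [],Opp A2 C3 C1 [],Opp A2 C3 C1 [],Opp A2 C3 C1 [],Opp A2 C3 C1 [],
  Opp A2 C3 C1 [],Opp A2 C3 C1 [],Opp A2 C4 C1 [],Opp A2 C4 C1 [],Opp A2 D1 C1 [Side B2 [Side A3
  [Side C1 [Side B3 [Side A4 [Side C3 [],Opp A4 C4 C3 [],Opp A0 B0 B4 [],Opp A0 B0 D4 [Opp A4 D3 C3
  [Side B4 [Leaf [C4,C3,B4,B0,A0,D4,D0,C0,C1,C2,A4,D3,A3,A1,A2,B3,D2,B2,B1,D1]]]],Side B4 [],Opp A0
  B0 D3 []]]]],Side A3 [Side C1 [Side C3 [Opp C4 D4 D3 []]],Opp C4 D4 A4 [Side C1 []]],Side A3 [Opp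
  D2 A4 C1 [Side A4 [Opp A0 B0 B4 []]],Opp D4 C4 A4 [Side C1 []]]]],Opp A2 D1 C1 [Side B2 [Side A3
  [Opp A3 B0 D2 [],Opp A3 B3 D2 [Side C2 [Side A4 [Opp A0 B0 C4 [Opp A4 C3 B4 [Side B4 [Leaf [A3,A4,
  B4,B3,C2,D2,D1,A2,A1,A0,C3,D3,C4,C1,C0,B0,B1,D4,B2,D0]]]],Opp A0 B0 D3 [Opp A4 C3 B4 [Opp C4 D4
  B4 [Leaf [B2,B1,D0,D1,A2,C1,C2,B3,B4,B0,A1,C0,A0,A3,A4,D4,C4,D3,D2,C3]]]],Opp A0 B0 C3 [Opp A4 C4
  B4 [Side B4 [Leaf [A0,A4,C4,C3,D3,B0,B1,A1,A2,A3,B4,D4,B3,C0,C1,D2,D1,C2,D0,B2]]]],Opp A0 B0 D4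
  [Opp A4 C4 B4 [Opp C3 B4 D3 [Leaf [B2,B3,C2,C1,A2,D1,D0,B1,B0,B4,A3,D2,A4,A1,A0,C3,D3,C4,C0,
  D4]]]],Opp A0 B0 C3 [Opp A4 D3 B4 [Opp C4 D4 B0 [Leaf [A2,A3,D2,D1,B2,C1,C0,A1,A0,A4,B3,C2,B4,B1,
  B0,D3,C3,D4,D0,C4]]]],Opp A0 B0 D4 [Opp A4 D3 B4 [Side B4 [Leaf [A2,A3,D2,D1,B2,C1,C0,A1,A0,A4,B3,
  C2,B4,B1,B0,D3,D4,C3,D0,C4]]]],Opp A0 B0 C4 [Opp A4 D4 B4 [Opp C3 B0 D3 [Leaf [A2,A1,C0,C1,B2,D1,
  D2,A3,A4,A0,B1,D0,B0,B3,B4,C4,D4,C3,C2,D3]]]],Opp A0 B0 D3 [Opp A4 D4 B4 [Side B4 [Leaf [A4,A0,D3,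
  D4,C4,B4,B3,A3,A2,A1,B0,C3,B1,D2,D1,C0,C1,D0,C2,B2]]]]]]],Opp A3 B3 D2 [Side C2 [Side A4 [Opp A0
  B0 D4 [Side B4 [Opp B4 C3 D2 [Leaf [D0,D4,C4,C0,A1,B1,B2,D1,D2,D3,A0,B0,A4,A2,A3,C3,B4,C2,C1,
  B3]]]]]]],Opp B0 A0 A4 [],Opp A3 B4 D2 [Opp B3 A4 C2 [Side A4 [Opp A0 B0 D4 [Side B4 [Side C2
  [Leaf [A4,A3,B4,B3,C2,D3,D4,A0,A1,A2,D2,C3,D1,B0,B1,C1,C0,B2,C4,D0]]]]]]],Opp A3 B4 D2 [Opp B0 A0
  D2 [Side A4 []],Opp B3 D2 C2 [Side B4 [Opp B0 A0 C4 [Side A4 [Opp A4 D3 C3 [Leaf [D0,D1,B2,B1,A1,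
  C0,C4,D4,D3,D2,A2,C1,A3,A0,A4,B3,C2,B4,B0,C3]]]]]]],Opp A3 B4 D2 [Opp B0 A0 D2 [],Opp B3 D2 C2
  []],Opp A3 C2 D2 [Side B3 [Side A4 [Opp A0 B0 D4 [Side B4 [Opp B4 C3 D3 [Leaf [A1,A2,C1,C0,D0,B1,
  B0,A0,A4,A3,D1,B2,D2,D4,D3,C2,B3,C3,C4,B4]]]]]]],Opp A3 C2 D2 [Side B3 [Side A4 [Side C3 [],Opp
  A4 C4 C3 [],Opp A0 B0 B4 [],Opp A0 B0 D4 [Opp A4 D3 C3 [Side B4 [Leaf [A1,A2,C1,C0,D0,B1,B0,A0,A4,
  A3,D1,B2,D2,D4,D3,C2,C3,B3,C4,B4]]]],Side B4 [],Opp A0 B0 D3 []]]],Opp A3 C3 D2 [Opp C2 D2 B3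
  [Side B3 [Side A4 [Opp A0 B0 D4 [Side B4 [Leaf [A1,A0,B0,B1,D0,C0,C1,A2,A3,A4,D4,C4,D3,D1,D2,B4,
  C3,B3,B2,C2]]]]]],Opp C4 D4 D2 []],Opp A3 C3 D2 [Opp C2 A4 B3 [Side A4 [Opp A0 B0 D4 [Side B3
  [Side B4 [Leaf [A3,A4,C2,C3,B4,D2,D1,A2,A1,A0,D3,B3,D4,C1,C0,B0,B1,C4,B2,D0]]]]]]],Opp A3 C3 D2
  [Opp C4 D4 A4 []],Opp A3 C3 D2 [Opp C2 D2 B3 [],Opp C4 D4 D2 []],Opp A3 C4 D2 [],Opp A3 C4 D2
  [Side D2 [Side B3 []]],Opp A3 D3 D2 [],Opp A3 D3 D2 [],Opp A3 D3 D2 [],Opp A3 D4 D2 [],Opp A3 D4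
  D2 []]]],Opp A2 D2 C1 [Opp D1 C1 B2 [Side B2 [Side A3 [Side B3 [Side A4 [Side C3 [],Opp A4 C4 C3
  [],Opp A0 B0 B4 [],Opp A0 B0 D4 [Opp A4 D3 C3 [Side B4 [Leaf [C4,C0,D0,D4,A0,B0,B4,C3,C2,C1,A1,B1,
  A2,A4,A3,D1,B2,D2,D3,B3]]]],Side B4 [],Opp A0 B0 D3 []]]]]],Side D1 [Opp D1 B4 B2 []]],Opp A2 D2
  C1 [Opp D1 C1 B2 [Side B2 [Side C2 [Side C3 [],Side A4 [Side C3 []]],Side D2 []]],Side C1 [Side
  A3 [Opp A3 B3 B4 [],Opp A3 D4 B4 []],Side D1 [Opp B0 A0 D1 []]]],Opp A2 D2 C1 [Opp D1 C1 B2 [],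
  Side C1 [Side A3 [Side C2 [Opp D1 C3 B2 []]]]],Opp A2 D2 C1 [Opp D1 C1 B2 [Side B2 [Side C2 [],
  Side C2 [Side C3 [Side A4 []]]]],Side D1 [Opp D1 C2 B2 [Side C1 []],Opp C4 D4 D1 []]],Opp A2 D2
  C1 [Opp D1 A3 B2 [Side A3 [Side B2 [Side B3 [Side A4 [Side C3 [],Opp A4 C4 C3 [],Opp A0 B0 B4 [],
  Opp A0 B0 D4 [Opp A4 D3 C3 [Side B4 [Leaf [A3,A2,D2,D1,B2,C2,C3,A4,A0,A1,C1,B3,C0,D3,D4,B1,B0,D0,
  B4,C4]]]],Side B4 [],Opp A0 B0 D3 []]]]],Side B2 []],Opp D1 A3 B2 [Side C1 [],Side A3 [Side C3
  [Opp C4 D4 B3 []],Opp C4 D4 A4 [Side A4 []]]]],Opp A2 D2 C1 [Side D1 [Opp D1 B4 B2 []],Side C1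
  [Opp B0 A0 C2 [],Side B4 [Opp B0 A0 D1 [],Opp B0 A0 D3 []]]],Opp A2 D3 C1 [Side C1 [Side A3 [Opp
  A3 B4 B3 [],Opp A3 D1 B3 []],Side D1 [Opp B0 A0 D1 []]],Opp D4 C4 C1 []],Opp A2 D3 C1 [Side C1
  [Side A3 [Opp A3 B3 B4 [],Opp A3 D1 B4 []],Side D1 []],Opp D4 C4 C1 []],Opp A2 D3 C1 [Side C1
  [Side A3 [Opp D1 A4 B2 [Side C2 []]]],Opp D4 C4 C1 []],Opp A2 D3 C1 [Side D3 [Opp D4 C4 C2 []],
  Opp D4 C4 C1 []],Opp A2 D3 C1 [Side C1 [Opp B2 C2 D1 [Side A3 [Opp A3 C3 D2 [Side A4 []]]],Side
  B2 [Opp B2 D2 D1 [],Opp B2 D4 D1 []]],Side C1 [Opp B0 A0 C2 [],Side B4 [Opp B0 A0 D2 [],Opp B0 A0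
  D4 [Side A4 [Side A3 [Opp A3 B2 D2 [],Side C2 [],Opp A3 B3 D2 [Opp A4 C3 B2 [Side C2 [Leaf [A0,A1,
  B1,B0,D4,C4,C3,A4,A3,A2,C0,D0,C1,B2,B3,D3,D2,B4,D1,C2]]]],Opp A4 C3 C2 [],Side D1 [],Opp A3 D1 D2
  []]]]]]],Opp A2 D3 C1 [Opp D4 C4 A3 [Side B3 []],Opp D4 C4 A3 [Side B3 []]],Opp A2 D4 C1 [Side C1
  [Side D2 [Opp A0 B0 D2 [Side B2 []],Opp A3 D2 C4 [Side A4 [Opp A0 B0 B3 [],Opp A0 B0 B4 []]]],
  Side C3 [Side B3 [],Side D2 []],Side C3 [Side B3 [],Side D2 []]]],Opp A2 D4 C1 []]]"

text \<open>The whole tree is checked by simplification, so the computation passes through the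
  kernel.\<close>

lemma search_cert: "search start certificate"
  by code_simp

section \<open>The local structure of the map\<close>

locale map_4445 =
  fixes X :: "'a cell_map"
  assumes semi: "semi_equivelar [4, 4, 4, 5] X"
begin

lemma X_map: "is_map X" "polyhedral_map X"
  using semi unfolding semi_equivelar_def polyhedral_map_def by auto

lemma finite_cells: "finite (vertices X)" "finite (edges X)" "finite (faces X)"
  using X_map(1) unfolding is_map_def by auto

lemma X_cells:
  "e \<in> edges X \<Longrightarrow> is_edge_cell X e" "F \<in> faces X \<Longrightarrow> is_face_cell X F"
  "inj_on (\<lambda>e. e \<inter> vertices X) (edges X)"
  using X_map(1) unfolding is_map_def by simp_all

section \<open>From topological cells to vertex cycles\<close>

lemma edge_ends:
  assumes "e \<in> edges X"
  obtains a b where "a \<noteq> b" "e \<inter> vertices X = {a, b}"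
proof -
  obtain g where g: "homeomorphic_map (top_of_set {0..1::real}) (subtopology (surface X) e) g"
    "e \<inter> vertices X = {g 0, g 1}"
    using X_cells(1)[OF assms] unfolding is_edge_cell_def by (elim exE conjE)
  have "inj_on g {0..1}" using homeomorphic_imp_injective_map[OF g(1)] by simp
  then have "g 0 \<noteq> g 1" by (auto dest: inj_onD[where x = 0 and y = 1])
  then show thesis using that g(2) by metis
qed

text \<open>A closed face meets the skeleton only in its boundary circle, which is the union of its
  edges.\<close>

lemma face_vertices:
  assumes "F \<in> faces X" "boundary_cycle X F = cycle_edges vs"
  shows "F \<inter> vertices X = set vs"
proof -
  obtain h :: "real^2 \<Rightarrow> 'a" where h: "F \<inter> skeleton X = h ` sphere 0 1"
    "h ` sphere 0 1 = \<Union>(face_edges X F)"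
    using X_cells(2)[OF assms(1)] unfolding is_face_cell_def by (elim exE conjE)
  have "F \<inter> skeleton X = \<Union>(face_edges X F)" using h by simp
  moreover have "vertices X \<subseteq> skeleton X" unfolding skeleton_def by simp
  ultimately have "F \<inter> vertices X = \<Union>(face_edges X F) \<inter> vertices X" by blast
  also have "\<dots> = \<Union>(boundary_cycle X F)" unfolding boundary_cycle_def by blast
  finally show ?thesis using assms(2) Union_cycle_edges by metis
qed

lemma card_boundary: "card (boundary_cycle X F) = card (face_edges X F)"
proof -
  have "inj_on (\<lambda>e. e \<inter> vertices X) (face_edges X F)"
    using X_cells(3) by (rule inj_on_subset) (auto simp: face_edges_def)
  then show ?thesis unfolding boundary_cycle_def by (rule card_image)
qed

lemma face_cycle:
  assumes "F \<in> faces X"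
  obtains vs where "distinct vs" "set vs = F \<inter> vertices X" "boundary_cycle X F = cycle_edges vs"
    "length vs = card (face_edges X F)" "3 \<le> length vs"
proof -
  obtain vs where vs: "distinct vs" "3 \<le> length vs" "boundary_cycle X F = cycle_edges vs"
    using X_cells(2)[OF assms] unfolding is_face_cell_def by (elim exE conjE)
  then have "length vs = card (face_edges X F)" using card_cycle_edges card_boundary by metis
  then show thesis using that vs face_vertices[OF assms] by metis
qed

lemma card_face_vertices:
  assumes "F \<in> faces X"
  shows "card (F \<inter> vertices X) = card (face_edges X F)"
  using face_cycle[OF assms] by (metis distinct_card)

text \<open>Two common vertices leave only an edge as the intersection, and an edge has just two
  vertices.\<close>

lemma face_meet:
  assumes "F \<in> faces X" "G \<in> faces X" "F \<noteq> G" "a \<in> F \<inter> G" "b \<in> F \<inter> G"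
    "a \<in> vertices X" "b \<in> vertices X" "a \<noteq> b"
  shows "F \<inter> G \<inter> vertices X = {a, b}" "{a, b} \<in> boundary_cycle X F"
proof -
  have "F \<inter> G = {} \<or> (\<exists>v\<in>vertices X. F \<inter> G = {v}) \<or> F \<inter> G \<in> edges X"
    using X_map(2) assms(1-3) unfolding polyhedral_map_def by simp
  then have e: "F \<inter> G \<in> edges X" using assms(4,5,8) by (metis empty_iff singletonD)
  then obtain c d where "F \<inter> G \<inter> vertices X = {c, d}" using edge_ends by metis
  moreover have "a \<in> F \<inter> G \<inter> vertices X" "b \<in> F \<inter> G \<inter> vertices X" using assms(4-7) by auto
  ultimately show *: "F \<inter> G \<inter> vertices X = {a, b}" using assms(8) by auto
  have "F \<inter> G \<in> face_edges X F" unfolding face_edges_def using e by auto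
  then show "{a, b} \<in> boundary_cycle X F" unfolding boundary_cycle_def using * by (metis image_eqI)
qed

text \<open>A face is represented by every reading of its boundary, so rotations and reversals may
  be chosen freely.\<close>

definition face :: "'a list \<Rightarrow> bool" where
  "face vs \<longleftrightarrow> distinct vs \<and> 3 \<le> length vs \<and>
    (\<exists>F\<in>faces X. boundary_cycle X F = cycle_edges vs)"

lemma face_in_vertices: "face vs \<Longrightarrow> set vs \<subseteq> vertices X"
  unfolding face_def using face_vertices by blast

lemma face_distinct: "face vs \<Longrightarrow> distinct vs"
  unfolding face_def by blast

lemma face_transfer:
  assumes "face vs" "cycle_edges ws = cycle_edges vs" "distinct ws" "length ws = length vs"
  shows "face ws"
  using assms unfolding face_def by simp

text \<open>Polyhedrality in terms of vertices alone. Its main use is that a diagonal of one face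
  cannot lie in another face.\<close>

lemma face_compat:
  assumes "face q" "face r" "cycle_edges q \<noteq> cycle_edges r" "a \<noteq> b"
    "a \<in> set q" "a \<in> set r" "b \<in> set q" "b \<in> set r"
  shows "{a, b} \<in> cycle_edges q"
proof -
  obtain F where F: "F \<in> faces X" "boundary_cycle X F = cycle_edges q"
    using assms(1) unfolding face_def by blast
  obtain G where G: "G \<in> faces X" "boundary_cycle X G = cycle_edges r"
    using assms(2) unfolding face_def by blast
  have "F \<noteq> G" using F G assms(3) by auto
  moreover have "a \<in> F \<inter> G" "b \<in> F \<inter> G" "a \<in> vertices X" "b \<in> vertices X"
    using assms(5-8) face_vertices[OF F] face_vertices[OF G] by auto
  ultimately show ?thesis using face_meet(2)[OF F(1) G(1)] assms(4) F(2) by metis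
qed

section \<open>Faces around a vertex and the number of vertices\<close>

lemma around_vertex:
  assumes v: "v \<in> vertices X"
  obtains f0 f1 f2 f3 e0 e1 e2 e3 where
    "distinct [f0, f1, f2, f3]" "{f0, f1, f2, f3} = {f \<in> faces X. v \<in> f}"
    "distinct [e0, e1, e2, e3]" "{e0, e1, e2, e3} = {e \<in> edges X. v \<in> e}"
    "{e \<in> face_edges X f0. v \<in> e} = {e0, e1}" "{e \<in> face_edges X f1. v \<in> e} = {e1, e2}"
    "{e \<in> face_edges X f2. v \<in> e} = {e2, e3}" "{e \<in> face_edges X f3. v \<in> e} = {e3, e0}"
    "card (face_edges X f0) = 4" "card (face_edges X f1) = 4" "card (face_edges X f2) = 4"
    "card (face_edges X f3) = 5"
proof -
  have "\<exists>fs. faces_around X v fs \<and> map (\<lambda>f. card (face_edges X f)) fs = [4, 4, 4, 5]"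
    using semi v unfolding semi_equivelar_def by simp
  then obtain fs es where fs: "distinct fs" "set fs = {f \<in> faces X. v \<in> f}"
    "map (\<lambda>f. card (face_edges X f)) fs = [4, 4, 4, 5]"
    and es: "distinct es" "set es = {e \<in> edges X. v \<in> e}" "length es = length fs"
    "\<forall>i < length fs. {e \<in> face_edges X (fs ! i). v \<in> e} = {es ! i, es ! (Suc i mod length es)}"
    unfolding faces_around_def by (elim exE conjE)
  have "length fs = 4" using arg_cong[OF fs(3), of length] by simp
  moreover from this have "length es = 4" using es(3) by simp
  ultimately obtain f0 f1 f2 f3 e0 e1 e2 e3 where l: "fs = [f0, f1, f2, f3]" "es = [e0, e1, e2, e3]"
    using length4_conv[of fs] length4_conv[of es] by blast
  have "{e \<in> face_edges X f0. v \<in> e} = {e0, e1}" "{e \<in> face_edges X f1. v \<in> e} = {e1, e2}"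
    "{e \<in> face_edges X f2. v \<in> e} = {e2, e3}" "{e \<in> face_edges X f3. v \<in> e} = {e3, e0}"
    using es(4)[rule_format, of 0] es(4)[rule_format, of 1] es(4)[rule_format, of 2]
      es(4)[rule_format, of 3] unfolding l by simp_all
  then show thesis
    by (rule that[of f0 f1 f2 f3 e0 e1 e2 e3, rotated 4]) (use fs es l in simp_all)
qed

lemma face_size:
  assumes "F \<in> faces X"
  shows "card (face_edges X F) = 4 \<or> card (face_edges X F) = 5"
proof -
  obtain vs where "set vs = F \<inter> vertices X" "3 \<le> length vs" using face_cycle[OF assms] by metis
  then obtain v where v: "v \<in> F" "v \<in> vertices X" by (cases vs) auto
  obtain f0 f1 f2 f3 where f: "{f0, f1, f2, f3} = {f \<in> faces X. v \<in> f}"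
    and c: "card (face_edges X f0) = 4" "card (face_edges X f1) = 4" "card (face_edges X f2) = 4"
    "card (face_edges X f3) = 5" by (rule around_vertex[OF v(2)])
  have "F \<in> {f0, f1, f2, f3}" unfolding f using assms v by simp
  then show ?thesis using c by auto
qed

lemma sum_incidence:
  assumes "finite S" "\<And>v. v \<in> vertices X \<Longrightarrow> card {s \<in> S. v \<in> s} = k"
    "\<And>s. s \<in> S \<Longrightarrow> card (s \<inter> vertices X) = m"
  shows "m * card S = k * card (vertices X)"
proof -
  have "(\<Sum>s\<in>S. card {v \<in> vertices X. v \<in> s}) = k * card (vertices X)"
    using assms(1,2) finite_cells by (intro sum_multicount) auto
  moreover have "{v \<in> vertices X. v \<in> s} = s \<inter> vertices X" for s by auto
  ultimately show ?thesis using assms(3) by (simp add: mult.commute)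
qed

lemma counts:
  "2 * card (edges X) = 4 * card (vertices X)"
  "5 * card {F \<in> faces X. card (face_edges X F) = 5} = card (vertices X)"
  "4 * card {F \<in> faces X. card (face_edges X F) = 4} = 3 * card (vertices X)"
  "card (faces X) = card {F \<in> faces X. card (face_edges X F) = 4} +
     card {F \<in> faces X. card (face_edges X F) = 5}"
proof -
  show "2 * card (edges X) = 4 * card (vertices X)"
  proof (rule sum_incidence)
    fix v assume "v \<in> vertices X"
    then obtain e0 e1 e2 e3 where "distinct [e0, e1, e2, e3]"
      "{e0, e1, e2, e3} = {e \<in> edges X. v \<in> e}" by (rule around_vertex)
    then show "card {e \<in> edges X. v \<in> e} = 4" using distinct_card[of "[e0, e1, e2, e3]"] by simp
  next
    fix e assume "e \<in> edges X"
    then show "card (e \<inter> vertices X) = 2" by (metis edge_ends card_2_iff)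
  qed (use finite_cells in auto)
  have c: "card {F \<in> {F \<in> faces X. card (face_edges X F) = 5}. v \<in> F} = 1 \<and>
      card {F \<in> {F \<in> faces X. card (face_edges X F) = 4}. v \<in> F} = 3"
    if v: "v \<in> vertices X" for v
  proof -
    obtain f0 f1 f2 f3 where f: "distinct [f0, f1, f2, f3]" "{f0, f1, f2, f3} = {f \<in> faces X. v \<in> f}"
      "card (face_edges X f0) = 4" "card (face_edges X f1) = 4" "card (face_edges X f2) = 4"
      "card (face_edges X f3) = 5" by (rule around_vertex[OF v])
    have "{F \<in> {F \<in> faces X. card (face_edges X F) = k}. v \<in> F} =
      {F \<in> {f0, f1, f2, f3}. card (face_edges X F) = k}" for k using f(2) by auto
    moreover have "{F \<in> {f0, f1, f2, f3}. card (face_edges X F) = 5} = {f3}"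
      "{F \<in> {f0, f1, f2, f3}. card (face_edges X F) = 4} = {f0, f1, f2}" using f(3-6) by auto
    ultimately show ?thesis using f(1) by simp
  qed
  have "5 * card {F \<in> faces X. card (face_edges X F) = 5} = 1 * card (vertices X)"
    by (rule sum_incidence) (use finite_cells c card_face_vertices in auto)
  then show "5 * card {F \<in> faces X. card (face_edges X F) = 5} = card (vertices X)" by simp
  show "4 * card {F \<in> faces X. card (face_edges X F) = 4} = 3 * card (vertices X)"
    by (rule sum_incidence) (use finite_cells c card_face_vertices in auto)
  have "faces X = {F \<in> faces X. card (face_edges X F) = 4} \<union>
     {F \<in> faces X. card (face_edges X F) = 5}" using face_size by auto
  then have "card (faces X) = card ({F \<in> faces X. card (face_edges X F) = 4} \<union>
     {F \<in> faces X. card (face_edges X F) = 5})" by simp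
  also have "\<dots> = card {F \<in> faces X. card (face_edges X F) = 4} +
     card {F \<in> faces X. card (face_edges X F) = 5}"
    by (rule card_Un_disjoint) (use finite_cells in auto)
  finally show "card (faces X) = card {F \<in> faces X. card (face_edges X F) = 4} +
     card {F \<in> faces X. card (face_edges X F) = 5}" .
qed

text \<open>With \<open>V\<close> vertices there are \<open>2 V\<close> edges, \<open>V / 5\<close>
  pentagons and \<open>3 V / 4\<close> quadrilaterals, so the Euler characteristic is
  \<open>- V / 20\<close>.\<close>

lemma card_vertices_faces:
  assumes "euler_char X = -1"
  shows "card (vertices X) = 20" "card (faces X) = 19"
  using assms counts unfolding euler_char_def by linarith+

text \<open>The edges at \<open>v\<close> are replaced by their other ends. These are distinct, as
  there are no parallel edges, and inherit the cyclic order.\<close>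

lemma rotation:
  assumes v: "v \<in> vertices X"
  obtains n0 n1 n2 n3 c d u1 u2 u3 where
    "distinct [n0, n1, n2, n3]" "face [v, n1, c, d, n0]"
    "face [v, n1, u1, n2]" "face [v, n2, u2, n3]" "face [v, n3, u3, n0]"
    "\<forall>r. face r \<longrightarrow> v \<in> set r \<longrightarrow> cycle_edges r \<in> cycle_edges `
      {[v, n1, c, d, n0], [v, n1, u1, n2], [v, n2, u2, n3], [v, n3, u3, n0]}"
proof -
  obtain f0 f1 f2 f3 e0 e1 e2 e3 where f:
    "distinct [f0, f1, f2, f3]" "{f0, f1, f2, f3} = {f \<in> faces X. v \<in> f}"
    and e: "distinct [e0, e1, e2, e3]" "{e0, e1, e2, e3} = {e \<in> edges X. v \<in> e}"
    and fe: "{e \<in> face_edges X f0. v \<in> e} = {e0, e1}" "{e \<in> face_edges X f1. v \<in> e} = {e1, e2}"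
    "{e \<in> face_edges X f2. v \<in> e} = {e2, e3}" "{e \<in> face_edges X f3. v \<in> e} = {e3, e0}"
    and c: "card (face_edges X f0) = 4" "card (face_edges X f1) = 4" "card (face_edges X f2) = 4"
    "card (face_edges X f3) = 5"
    by (rule around_vertex[OF v])
  have "\<exists>m. m \<noteq> v \<and> x \<inter> vertices X = {v, m}" if "x \<in> {e0, e1, e2, e3}" for x
  proof -
    have x: "x \<in> edges X" "v \<in> x" using e(2) that by auto
    then obtain a b where "a \<noteq> b" "x \<inter> vertices X = {a, b}" using edge_ends by metis
    moreover from this have "v = a \<or> v = b" using v x by auto
    ultimately show ?thesis by (metis insert_commute)
  qed
  then obtain m where m: "\<And>x. x \<in> {e0, e1, e2, e3} \<Longrightarrow> m x \<noteq> v \<and> x \<inter> vertices X = {v, m x}"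
    by metis
  have m_inj: "m x \<noteq> m y" if "x \<in> {e0, e1, e2, e3}" "y \<in> {e0, e1, e2, e3}" "x \<noteq> y" for x y
  proof
    assume "m x = m y"
    then have "x \<inter> vertices X = y \<inter> vertices X" using m[OF that(1)] m[OF that(2)] by simp
    moreover have "x \<in> edges X" "y \<in> edges X" using that(1,2) e(2) by auto
    ultimately show False using inj_onD[OF X_cells(3)] that(3) by blast
  qed
  \<comment> \<open>The pentagon \<open>f3\<close> lies between \<open>e3\<close> and
    \<open>e0\<close>, so the list starts with the end of \<open>e3\<close>.\<close>
  have dist: "distinct [m e3, m e0, m e1, m e2]"
    using e(1) m_inj[of e0 e1] m_inj[of e0 e2] m_inj[of e0 e3] m_inj[of e1 e2] m_inj[of e1 e3]
      m_inj[of e2 e3] by simp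
  have bd: "{v, m x} \<in> boundary_cycle X F"
    if "{e \<in> face_edges X F. v \<in> e} = {x, y} \<or> {e \<in> face_edges X F. v \<in> e} = {y, x}"
      "x \<in> {e0, e1, e2, e3}" for F x y
  proof -
    have "x \<in> face_edges X F" using that(1) by blast
    then show ?thesis using m[OF that(2)] unfolding boundary_cycle_def by (metis image_eqI)
  qed
  have quad: "\<exists>u. distinct [v, m x, u, m y] \<and> boundary_cycle X F = cycle_edges [v, m x, u, m y]"
    if F: "{e \<in> face_edges X F. v \<in> e} = {x, y}" "card (face_edges X F) = 4" "F \<in> faces X"
      and xy: "x \<in> {e0, e1, e2, e3}" "y \<in> {e0, e1, e2, e3}" "x \<noteq> y" for F x y
  proof -
    obtain vs where vs: "distinct vs" "boundary_cycle X F = cycle_edges vs" "length vs = 4"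
      using face_cycle[OF F(3)] F(2) by metis
    have "{v, m x} \<in> cycle_edges vs" "{v, m y} \<in> cycle_edges vs"
      using bd[of F x y] bd[of F y x] F(1) xy vs(2) by simp_all
    then show ?thesis using corner4[OF vs(3,1) _ _ m_inj[OF xy]] vs(2) by metis
  qed
  have fF: "f0 \<in> faces X" "f1 \<in> faces X" "f2 \<in> faces X" "f3 \<in> faces X" using f(2) by auto
  obtain u1 where u1: "distinct [v, m e0, u1, m e1]" "boundary_cycle X f0 = cycle_edges [v, m e0, u1, m e1]"
    using quad[OF fe(1) c(1) fF(1)] e(1) by (metis distinct_length_2_or_more insertI1 insertI2)
  obtain u2 where u2: "distinct [v, m e1, u2, m e2]" "boundary_cycle X f1 = cycle_edges [v, m e1, u2, m e2]"
    using quad[OF fe(2) c(2) fF(2)] e(1) by (metis distinct_length_2_or_more insertI1 insertI2)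
  obtain u3 where u3: "distinct [v, m e2, u3, m e3]" "boundary_cycle X f2 = cycle_edges [v, m e2, u3, m e3]"
    using quad[OF fe(3) c(3) fF(3)] e(1) by (metis distinct_length_2_or_more insertI1 insertI2)
  obtain vs where vs: "distinct vs" "boundary_cycle X f3 = cycle_edges vs" "length vs = 5"
    using face_cycle[OF fF(4)] c(4) by metis
  have "{v, m e0} \<in> cycle_edges vs" "{v, m e3} \<in> cycle_edges vs"
    using bd[of f3 e0 e3] bd[of f3 e3 e0] fe(4) vs(2) by simp_all
  then obtain r s where rs: "distinct [v, m e0, r, s, m e3]"
    "boundary_cycle X f3 = cycle_edges [v, m e0, r, s, m e3]"
    using corner5[OF vs(3,1), of v "m e0" "m e3"] dist vs(2) by (metis distinct_length_2_or_more)
  have "cycle_edges q \<in> cycle_edges `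
      {[v, m e0, r, s, m e3], [v, m e0, u1, m e1], [v, m e1, u2, m e2], [v, m e2, u3, m e3]}"
    if q: "face q" "v \<in> set q" for q
  proof -
    obtain F where F: "F \<in> faces X" "boundary_cycle X F = cycle_edges q"
      using q(1) unfolding face_def by blast
    have "v \<in> F" using face_vertices[OF F] q(2) by blast
    then have "F \<in> {f0, f1, f2, f3}" using f(2) F(1) by blast
    then show ?thesis using F(2) u1(2) u2(2) u3(2) rs(2) by auto
  qed
  then have all: "\<forall>q. face q \<longrightarrow> v \<in> set q \<longrightarrow> cycle_edges q \<in> cycle_edges `
      {[v, m e0, r, s, m e3], [v, m e0, u1, m e1], [v, m e1, u2, m e2], [v, m e2, u3, m e3]}"
    by blast
  show thesis
    by (rule that[OF dist _ _ _ _ all]) (use u1 u2 u3 rs fF in \<open>auto simp: face_def\<close>)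
qed

lemma face4_rotate: "face [a, b, c, d] \<Longrightarrow> face [b, c, d, a]"
  by (rule face_transfer[of "[a, b, c, d]"]) (use face_distinct cycle_edges_rotate4 in fastforce)+

lemma face4_flip: "face [a, b, c, d] \<Longrightarrow> face [a, d, c, b]"
  by (rule face_transfer[of "[a, b, c, d]"]) (use face_distinct cycle_edges_flip4 in fastforce)+

lemma face5_rotate: "face [a, b, c, d, e] \<Longrightarrow> face [b, c, d, e, a]"
  by (rule face_transfer[of "[a, b, c, d, e]"]) (use face_distinct cycle_edges_rotate5 in fastforce)+

lemma face5_flip: "face [a, b, c, d, e] \<Longrightarrow> face [a, e, d, c, b]"
  by (rule face_transfer[of "[a, b, c, d, e]"]) (use face_distinct cycle_edges_flip5 in fastforce)+

lemma face_card: "face vs \<Longrightarrow> card (cycle_edges vs) = length vs"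
  unfolding face_def using card_cycle_edges by blast

lemma cycle_edges_ne_45: "face [a, b, c, d] \<Longrightarrow> face [p, q, r, s, t] \<Longrightarrow>
    cycle_edges [a, b, c, d] \<noteq> cycle_edges [p, q, r, s, t]"
  using face_card[of "[a, b, c, d]"] face_card[of "[p, q, r, s, t]"] by auto

lemma quad_eq:
  assumes "face [v, x, u, y]" "face [v, a, b, c]"
    "cycle_edges [v, x, u, y] = cycle_edges [v, a, b, c]"
  shows "(x = a \<and> y = c \<or> x = c \<and> y = a) \<and> u = b"
proof -
  have d: "distinct [v, x, u, y]" "distinct [v, a, b, c]" using assms face_distinct by blast+
  have "x = a \<or> x = c" "y = a \<or> y = c"
    using nbrs4[OF d(2)] nbrs4[OF d(1)] assms(3) by auto
  moreover have "{v, x, u, y} = {v, a, b, c}"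
    using Union_cycle_edges[of "[v, x, u, y]"] Union_cycle_edges[of "[v, a, b, c]"] assms(3) by simp
  ultimately show ?thesis using d by auto
qed

lemma pent_eq:
  assumes "face [v, p, r, s, q]" "face [v, a, b, c, d]"
    "cycle_edges [v, p, r, s, q] = cycle_edges [v, a, b, c, d]"
  shows "p = a \<and> q = d \<or> p = d \<and> q = a"
proof -
  have d: "distinct [v, p, r, s, q]" "distinct [v, a, b, c, d]" using assms face_distinct by blast+
  have "p = a \<or> p = d" "q = a \<or> q = d"
    using nbrs5[OF d(2)] nbrs5[OF d(1)] assms(3) by auto
  then show ?thesis using d by auto
qed

text \<open>Three of the four faces at \<open>v\<close> are quadrilaterals, whose cycles have a
  different number of edges.\<close>

lemma pent_unique:
  assumes "face [v, p, r, s, q]" "face [v, a, b, c, d]"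
  shows "cycle_edges [v, p, r, s, q] = cycle_edges [v, a, b, c, d]"
proof -
  have "v \<in> vertices X" using face_in_vertices[OF assms(1)] by simp
  then obtain n0 n1 n2 n3 c' d' u1 u2 u3 where n: "distinct [n0, n1, n2, n3]" "face [v, n1, c', d', n0]"
    "face [v, n1, u1, n2]" "face [v, n2, u2, n3]" "face [v, n3, u3, n0]"
    "\<forall>r. face r \<longrightarrow> v \<in> set r \<longrightarrow> cycle_edges r \<in> cycle_edges `
      {[v, n1, c', d', n0], [v, n1, u1, n2], [v, n2, u2, n3], [v, n3, u3, n0]}"
    by (rule rotation)
  have "cycle_edges [v, w, x, y, z] = cycle_edges [v, n1, c', d', n0]" if "face [v, w, x, y, z]"
    for w x y z
    using n(6)[rule_format, OF that] cycle_edges_ne_45[OF n(3) that] cycle_edges_ne_45[OF n(4) that]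
      cycle_edges_ne_45[OF n(5) that] by auto
  then show ?thesis using assms by simp
qed

text \<open>The given pentagon may run against the one from \<open>rotation\<close>; the
  quadrilaterals are then taken in reverse order. The six triples are the two readings from
  \<open>v\<close> of each quadrilateral.\<close>

lemma rotation_pent:
  assumes P: "face [v, p, c, d, q]"
  obtains n2 n3 u1 u2 u3 where
    "distinct [q, p, n2, n3]" "face [v, p, u1, n2]" "face [v, n2, u2, n3]" "face [v, n3, u3, q]"
    "\<forall>x u y. face [v, x, u, y] \<longrightarrow> (x, u, y) \<in> {(p, u1, n2), (n2, u1, p), (n2, u2, n3),
      (n3, u2, n2), (n3, u3, q), (q, u3, n3)}"
proof -
  have "v \<in> vertices X" using face_in_vertices[OF assms(1)] by simp
  then obtain n0 n1 n2 n3 c' d' u1 u2 u3 where n: "distinct [n0, n1, n2, n3]" "face [v, n1, c', d', n0]"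
    "face [v, n1, u1, n2]" "face [v, n2, u2, n3]" "face [v, n3, u3, n0]"
    "\<forall>r. face r \<longrightarrow> v \<in> set r \<longrightarrow> cycle_edges r \<in> cycle_edges `
      {[v, n1, c', d', n0], [v, n1, u1, n2], [v, n2, u2, n3], [v, n3, u3, n0]}"
    by (rule rotation)
  have quads: "(x, u, y) \<in> {(n1, u1, n2), (n2, u1, n1), (n2, u2, n3),
      (n3, u2, n2), (n3, u3, n0), (n0, u3, n3)}" if xuy: "face [v, x, u, y]" for x u y
  proof -
    consider "cycle_edges [v, x, u, y] = cycle_edges [v, n1, u1, n2]"
      | "cycle_edges [v, x, u, y] = cycle_edges [v, n2, u2, n3]"
      | "cycle_edges [v, x, u, y] = cycle_edges [v, n3, u3, n0]"
      using n(6)[rule_format, OF xuy] cycle_edges_ne_45[OF xuy n(2)] by auto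
    then show ?thesis
      using quad_eq[OF xuy n(3)] quad_eq[OF xuy n(4)] quad_eq[OF xuy n(5)] by cases auto
  qed
  consider "p = n1" "q = n0" | "p = n0" "q = n1"
    using pent_eq[OF P n(2) pent_unique[OF P n(2)]] by blast
  then show thesis
  proof cases
    case 1
    then show thesis using that[of n2 n3 u1 u2 u3] n quads by simp
  next
    case 2
    have "face [v, n0, u3, n3]" "face [v, n3, u2, n2]" "face [v, n2, u1, n1]"
      using n(3-5) face4_flip by blast+
    then show thesis using that[of n3 n2 u3 u2 u1] n(1) quads 2 by auto
  qed
qed

section \<open>Pentagon edges and straight edges\<close>

definition pent_edge :: "'a \<Rightarrow> 'a \<Rightarrow> bool" where
  "pent_edge x y \<longleftrightarrow> (\<exists>c d e. face [x, y, c, d, e])"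

lemma pent_edge_sym: "pent_edge x y \<Longrightarrow> pent_edge y x"
  unfolding pent_edge_def using face5_rotate face5_flip by metis

lemma pent_edge_iff:
  assumes "face [v, p, c, d, q]"
  shows "pent_edge v x \<longleftrightarrow> x = p \<or> x = q"
proof
  assume "pent_edge v x"
  then show "x = p \<or> x = q"
    unfolding pent_edge_def using pent_eq[OF _ assms] pent_unique[OF _ assms] by metis
next
  assume "x = p \<or> x = q"
  then show "pent_edge v x" unfolding pent_edge_def using assms face5_flip by blast
qed

lemma pent_rotate_to:
  assumes "face [a, b, c, d, e]" "x \<in> {a, b, c, d, e}"
  obtains p r s q where "face [x, p, r, s, q]" "{x, p, r, s, q} = {a, b, c, d, e}"
proof -
  obtain p r s q where *: "cycle_edges [x, p, r, s, q] = cycle_edges [a, b, c, d, e]"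
    "distinct [x, p, r, s, q]"
    by (rule rotate_to5[of "[a, b, c, d, e]" x, OF _ face_distinct[OF assms(1)]])
      (use assms(2) in simp_all)
  have "face [x, p, r, s, q]" by (rule face_transfer[OF assms(1) *]) simp
  moreover have "{x, p, r, s, q} = {a, b, c, d, e}"
    using Union_cycle_edges[of "[x, p, r, s, q]"] Union_cycle_edges[of "[a, b, c, d, e]"] *(1) by simp
  ultimately show thesis using that by blast
qed

lemma quad_edge_pent:
  assumes "face [x, b, c, d]" "face [p0, p1, p2, p3, p4]" "{x, b} \<subseteq> {p0, p1, p2, p3, p4}"
  shows "pent_edge x b"
proof -
  obtain p r s q where P: "face [x, p, r, s, q]" "{x, p, r, s, q} = {p0, p1, p2, p3, p4}"
    using pent_rotate_to[OF assms(2), of x] assms(3) by blast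
  have "x \<noteq> b" using face_distinct[OF assms(1)] by simp
  moreover have "b \<in> set [x, p, r, s, q]" using P(2) assms(3) by simp
  ultimately have "{x, b} \<in> cycle_edges [x, p, r, s, q]"
    using face_compat[OF P(1) assms(1) cycle_edges_ne_45[OF assms(1) P(1), symmetric], of x b] by simp
  then show ?thesis using nbrs5[OF face_distinct[OF P(1)]] pent_edge_iff[OF P(1)] by blast
qed

text \<open>The quadrilateral and the pentagon would share two vertices, so by
  \<open>face_compat\<close> the diagonal would be an edge of the quadrilateral.\<close>

lemma quad_diag_pent:
  assumes "face [x, b, y, d]" "face [p0, p1, p2, p3, p4]" "{x, y} \<subseteq> {p0, p1, p2, p3, p4}"
  shows False
proof -
  have d: "distinct [x, b, y, d]" using face_distinct[OF assms(1)] .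
  have "{x, y} \<in> cycle_edges [x, b, y, d]"
    using face_compat[OF assms(1,2) cycle_edges_ne_45[OF assms(1,2)], of x y] d assms(3) by simp
  then show False using nbrs4[OF d] d by auto
qed

text \<open>The two pentagon edges at \<open>w\<close> are consecutive among its four edges, so each
  of the other two edges has one pentagon edge and one other edge beside it. As \<open>a\<close> and
  \<open>b\<close> differ, the two quadrilaterals lie on different sides of
  \<open>w v\<close>.\<close>

lemma pent_edge_link:
  assumes "face [w, v, a, x]" "face [w, v, b, y]" "a \<noteq> b" "\<not> pent_edge w v"
  shows "pent_edge w x \<noteq> pent_edge w y"
proof -
  have "w \<in> vertices X" using face_in_vertices[OF assms(1)] by simp
  then obtain p q c d where P: "face [w, p, c, d, q]" by (rule rotation)
  then obtain n2 n3 u1 u2 u3 where n: "distinct [q, p, n2, n3]" "face [w, p, u1, n2]"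
    "face [w, n2, u2, n3]" "face [w, n3, u3, q]"
    "\<forall>x u y. face [w, x, u, y] \<longrightarrow> (x, u, y) \<in> {(p, u1, n2), (n2, u1, p), (n2, u2, n3),
      (n3, u2, n2), (n3, u3, q), (q, u3, n3)}"
    by (rule rotation_pent)
  show ?thesis
    using n(1) n(5)[rule_format, OF assms(1)] n(5)[rule_format, OF assms(2)] assms(3,4) unfolding pent_edge_iff[OF P] by auto
qed

definition straight :: "'a \<Rightarrow> 'a \<Rightarrow> bool" where
  "straight a b \<longleftrightarrow> (\<exists>x y. face [a, b, y, x] \<and> pent_edge x y)"

lemma straight_sym: "straight a b \<Longrightarrow> straight b a"
  unfolding straight_def using face4_rotate face4_flip pent_edge_sym by metis

text \<open>Neither \<open>v n2\<close> nor \<open>v n3\<close> is a pentagon edge, so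
  \<open>pent_edge_link\<close> applies at \<open>n2\<close> and at \<open>n3\<close>. The last
  claim is what forces a straight edge at \<open>v\<close>.\<close>

lemma opposite_quad:
  assumes P: "face [v, p, c, d, q]"
    and n: "distinct [q, p, n2, n3]" "face [v, p, u1, n2]" "face [v, n2, u2, n3]" "face [v, n3, u3, q]"
  shows "\<not> pent_edge n2 v" "\<not> pent_edge n3 v" "pent_edge n2 u1 \<noteq> pent_edge n2 u2"
    "pent_edge n3 u3 \<noteq> pent_edge n3 u2" "\<not> (pent_edge n2 u2 \<and> pent_edge n3 u2)"
proof -
  show *: "\<not> pent_edge n2 v" "\<not> pent_edge n3 v"
    using pent_edge_iff[OF P] pent_edge_sym[of n2 v] pent_edge_sym[of n3 v] n(1) by auto
  have f2: "face [n2, v, p, u1]" "face [n2, v, n3, u2]"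
    using n(2,3) face4_rotate face4_flip by metis+
  show "pent_edge n2 u1 \<noteq> pent_edge n2 u2"
    by (rule pent_edge_link[OF f2 _ *(1)]) (use n(1) in auto)
  have f3: "face [n3, v, q, u3]" "face [n3, v, n2, u2]"
    using n(3,4) face4_rotate face4_flip by metis+
  show "pent_edge n3 u3 \<noteq> pent_edge n3 u2"
    by (rule pent_edge_link[OF f3 _ *(2)]) (use n(1) in auto)
  show "\<not> (pent_edge n2 u2 \<and> pent_edge n3 u2)"
  proof
    assume "pent_edge n2 u2 \<and> pent_edge n3 u2"
    then have e: "pent_edge u2 n2" "pent_edge u2 n3" using pent_edge_sym by auto
    obtain r s t where R: "face [u2, n2, r, s, t]" using e(1) unfolding pent_edge_def by blast
    \<comment> \<open>Both edges at \<open>u2\<close> belong to the only pentagon there, which then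
      contains the opposite corners \<open>n2\<close> and \<open>n3\<close> of the
      quadrilateral.\<close>
    have "n3 = t" using pent_edge_iff[OF R] e(2) n(1) by auto
    moreover have "face [n2, u2, n3, v]" using n(3) face4_rotate by blast
    ultimately show False using quad_diag_pent[OF _ R, of n2 u2 n3 v] by simp
  qed
qed

lemma straight_or_straight:
  assumes P: "face [v, p, c, d, q]"
  shows "straight v p \<or> straight v q"
proof -
  obtain n2 n3 u1 u2 u3 where n: "distinct [q, p, n2, n3]" "face [v, p, u1, n2]"
    "face [v, n2, u2, n3]" "face [v, n3, u3, q]"
    by (rule rotation_pent[OF P])
  have "pent_edge n2 u1 \<or> pent_edge n3 u3" using opposite_quad[OF P n] by blast
  moreover have "face [v, q, u3, n3]" using n(4) face4_flip by blast
  ultimately show ?thesis unfolding straight_def using n(2) by blast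
qed

text \<open>A pentagon is an odd cycle, so two consecutive edges of it are straight.\<close>

lemma straight_corner:
  assumes "vertices X \<noteq> {}"
  obtains v p c d q where "face [v, p, c, d, q]" "straight v p" "straight v q"
proof -
  obtain v where "v \<in> vertices X" using assms by blast
  then obtain a b c d e where "face [a, b, c, d, e]" by (rule rotation)
  then have f: "face [a, b, c, d, e]" "face [b, c, d, e, a]" "face [c, d, e, a, b]"
    "face [d, e, a, b, c]" "face [e, a, b, c, d]" using face5_rotate by blast+
  show thesis
    using straight_or_straight[OF f(1)] straight_or_straight[OF f(2)] straight_or_straight[OF f(3)]
      straight_or_straight[OF f(4)] straight_or_straight[OF f(5)] straight_sym that f by metis
qed

text \<open>Pentagons with a common vertex coincide, and then \<open>x\<close> and \<open>y\<close>
  would lie in the same one.\<close>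

lemma pents_disjoint:
  assumes "face [a0, a1, a2, a3, a4]" "face [b0, b1, b2, b3, b4]"
    "x \<in> {a0, a1, a2, a3, a4}" "y \<in> {b0, b1, b2, b3, b4}"
    and sep: "\<And>p0 p1 p2 p3 p4. face [p0, p1, p2, p3, p4] \<Longrightarrow> \<not> {x, y} \<subseteq> {p0, p1, p2, p3, p4}"
  shows "{a0, a1, a2, a3, a4} \<inter> {b0, b1, b2, b3, b4} = {}"
proof (rule ccontr)
  assume "{a0, a1, a2, a3, a4} \<inter> {b0, b1, b2, b3, b4} \<noteq> {}"
  then obtain z where z: "z \<in> {a0, a1, a2, a3, a4}" "z \<in> {b0, b1, b2, b3, b4}" by blast
  obtain p r s q where P: "face [z, p, r, s, q]" "{z, p, r, s, q} = {a0, a1, a2, a3, a4}"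
    using pent_rotate_to[OF assms(1) z(1)] by blast
  obtain p' r' s' q' where Q: "face [z, p', r', s', q']" "{z, p', r', s', q'} = {b0, b1, b2, b3, b4}"
    using pent_rotate_to[OF assms(2) z(2)] by blast
  have "{z, p, r, s, q} = {z, p', r', s', q'}"
    using pent_unique[OF P(1) Q(1)] Union_cycle_edges[of "[z, p, r, s, q]"]
      Union_cycle_edges[of "[z, p', r', s', q']"] by simp
  then have "y \<in> {a0, a1, a2, a3, a4}" using P(2) Q(2) assms(4) by simp
  then show False using sep[OF assms(1)] assms(3) by blast
qed

section \<open>Labelling the vertices\<close>

definition labelling :: "(label \<Rightarrow> 'a) \<Rightarrow> bool" where
  "labelling f \<longleftrightarrow> bij_betw f UNIV (vertices X) \<and> (\<forall>l. face (map f (pent l)))"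

definition face4 :: "(label \<Rightarrow> 'a) \<Rightarrow> quad \<Rightarrow> bool" where
  "face4 f q = (case q of (a, b, c, d) \<Rightarrow> face [f a, f b, f c, f d])"

lemma labelling_exists:
  assumes card: "card (vertices X) = 20"
  obtains f where "labelling f" "\<And>q. q \<in> set start \<Longrightarrow> face4 f q"
proof -
  have "vertices X \<noteq> {}" using card by auto
  then obtain v p c d q where A: "face [v, p, c, d, q]" and st: "straight v p" "straight v q"
    by (rule straight_corner)
  obtain n2 n3 u1 u2 u3 where n: "distinct [q, p, n2, n3]" "face [v, p, u1, n2]"
    "face [v, n2, u2, n3]" "face [v, n3, u3, q]"
    and quads: "\<forall>x u y. face [v, x, u, y] \<longrightarrow> (x, u, y) \<in> {(p, u1, n2), (n2, u1, p), (n2, u2, n3),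
      (n3, u2, n2), (n3, u3, q), (q, u3, n3)}"
    by (rule rotation_pent[OF A])
  note opp = opposite_quad[OF A n]
  obtain x y where xy: "face [v, p, y, x]" "pent_edge x y" using st(1) unfolding straight_def by blast
  \<comment> \<open>Only one quadrilateral at \<open>v\<close> contains \<open>p\<close>, so
    straightness of \<open>v p\<close> speaks of its edge \<open>n2 u1\<close>.\<close>
  have e2: "pent_edge n2 u1" using quads[rule_format, OF xy(1)] xy(2) n(1) by auto
  obtain x y where xy: "face [v, q, y, x]" "pent_edge x y" using st(2) unfolding straight_def by blast
  have e3: "pent_edge n3 u3" using quads[rule_format, OF xy(1)] xy(2) n(1) by auto
  have ne: "\<not> pent_edge n2 u2" "\<not> pent_edge n3 u2" using opp(3,4) e2 e3 by auto
  obtain c2 c3 c4 where C: "face [n2, u1, c2, c3, c4]" using e2 unfolding pent_edge_def by blast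
  obtain b2 b3 b4 where B: "face [u3, n3, b2, b3, b4]"
    using pent_edge_sym[OF e3] unfolding pent_edge_def by blast
  have B': "face [n3, b2, b3, b4, u3]" using face5_rotate[OF B] .
  have q3: "face [n3, v, q, u3]" "face [n3, v, n2, u2]"
    using n(3,4) face4_rotate face4_flip by metis+
  obtain m2 m3 w1 w2 w3 where m: "distinct [u3, b2, m2, m3]" "face [n3, b2, w1, m2]"
    "face [n3, m2, w2, m3]" "face [n3, m3, w3, u3]"
    "\<forall>x u y. face [n3, x, u, y] \<longrightarrow> (x, u, y) \<in> {(b2, w1, m2), (m2, w1, b2), (m2, w2, m3),
      (m3, w2, m2), (m3, w3, u3), (u3, w3, m3)}"
    by (rule rotation_pent[OF B'])
  have "v \<noteq> b2" "v \<noteq> u3" using opp(2) pent_edge_iff[OF B'] by auto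
  moreover have "q \<noteq> n2" using n(1) by simp
  moreover have "u2 \<noteq> b2" "u2 \<noteq> u3" using ne(2) pent_edge_iff[OF B'] by auto
  \<comment> \<open>At \<open>n3\<close> the quadrilateral through \<open>u3\<close> and
    \<open>v\<close> is on a pentagon edge, so the one through \<open>v\<close> and
    \<open>u2\<close> is the middle one and the third uses \<open>b2\<close> and
    \<open>u2\<close>.\<close>
  ultimately have "m2 = u2" using m(5)[rule_format, OF q3(1)] m(5)[rule_format, OF q3(2)] m(1) by auto
  then have w1: "face [n3, b2, w1, u2]" using m(2) by simp
  have "face [u2, n3, b2, w1]" "face [u2, n3, v, n2]"
    using w1 n(3) face4_rotate face4_flip by metis+
  \<comment> \<open>Of the two edges beside \<open>u2 n3\<close> at \<open>u2\<close> exactly one is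
    a pentagon edge, and \<open>u2 n2\<close> is not.\<close>
  then have "pent_edge u2 w1 \<noteq> pent_edge u2 n2"
    using pent_edge_link[of u2 n3 b2 w1 v n2] \<open>v \<noteq> b2\<close> ne(2) pent_edge_sym by blast
  then have "pent_edge u2 w1" using ne(1) pent_edge_sym by blast
  then obtain d2 d3 d4 where D: "face [u2, w1, d2, d3, d4]" unfolding pent_edge_def by blast
  have A': "face [q, v, p, c, d]" using A face5_rotate by blast
  \<comment> \<open>The arguments follow the order of the constructors. Each pentagon starts where
    the four known quadrilaterals become those of \<open>start\<close>.\<close>
  define f where "f = case_label q v p c d u3 n3 b2 b3 b4 n2 u1 c2 c3 c4 u2 w1 d2 d3 d4"
  \<comment> \<open>Among the corners of the third quadrilateral, opposite ones are separated
    because they span a diagonal, adjacent ones because no side is a pentagon edge.\<close>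
  have s: "\<not> {v, n3} \<subseteq> {p0, p1, p2, p3, p4}" "\<not> {v, n2} \<subseteq> {p0, p1, p2, p3, p4}"
    "\<not> {v, u2} \<subseteq> {p0, p1, p2, p3, p4}" "\<not> {n3, n2} \<subseteq> {p0, p1, p2, p3, p4}"
    "\<not> {n3, u2} \<subseteq> {p0, p1, p2, p3, p4}" "\<not> {n2, u2} \<subseteq> {p0, p1, p2, p3, p4}"
    if P: "face [p0, p1, p2, p3, p4]" for p0 p1 p2 p3 p4
  proof -
    have g: "face [n2, u2, n3, v]" "face [n3, u2, n2, v]" using n(3) face4_rotate face4_flip by metis+
    have nv: "\<not> pent_edge v n2" "\<not> pent_edge v n3" using opp(1,2) pent_edge_sym by blast+
    show "\<not> {n3, n2} \<subseteq> {p0, p1, p2, p3, p4}" by (rule notI) (rule quad_diag_pent[OF g(2) P])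
    show "\<not> {v, u2} \<subseteq> {p0, p1, p2, p3, p4}" by (rule notI) (rule quad_diag_pent[OF n(3) P])
    show "\<not> {n2, u2} \<subseteq> {p0, p1, p2, p3, p4}" by (rule contrapos_nn[OF ne(1) quad_edge_pent[OF g(1) P]])
    show "\<not> {n3, u2} \<subseteq> {p0, p1, p2, p3, p4}" by (rule contrapos_nn[OF ne(2) quad_edge_pent[OF g(2) P]])
    show "\<not> {v, n2} \<subseteq> {p0, p1, p2, p3, p4}" by (rule contrapos_nn[OF nv(1) quad_edge_pent[OF n(3) P]])
    show "\<not> {v, n3} \<subseteq> {p0, p1, p2, p3, p4}" by (rule contrapos_nn[OF nv(2) quad_edge_pent[OF n(4) P]])
  qed
  let ?A = "{q, v, p, c, d}" and ?B = "{u3, n3, b2, b3, b4}" and ?C = "{n2, u1, c2, c3, c4}"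
    and ?D = "{u2, w1, d2, d3, d4}"
  have disj: "?A \<inter> ?B = {}" "?A \<inter> ?C = {}" "?A \<inter> ?D = {}" "?B \<inter> ?C = {}" "?B \<inter> ?D = {}" "?C \<inter> ?D = {}"
    using pents_disjoint[OF A' B _ _ s(1)] pents_disjoint[OF A' C _ _ s(2)]
      pents_disjoint[OF A' D _ _ s(3)] pents_disjoint[OF B C _ _ s(4)]
      pents_disjoint[OF B D _ _ s(5)] pents_disjoint[OF C D _ _ s(6)] by simp_all
  have cards: "card ?A = 5" "card ?B = 5" "card ?C = 5" "card ?D = 5"
    using face_distinct[OF A'] face_distinct[OF B] face_distinct[OF C] face_distinct[OF D]
      distinct_card[of "[q, v, p, c, d]"] distinct_card[of "[u3, n3, b2, b3, b4]"]
      distinct_card[of "[n2, u1, c2, c3, c4]"] distinct_card[of "[u2, w1, d2, d3, d4]"] by simp_all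
  let ?U = "?A \<union> (?B \<union> (?C \<union> ?D))"
  have "card (?C \<union> ?D) = 10" using card_Un_disjoint[OF _ _ disj(6)] cards by simp
  moreover have "?B \<inter> (?C \<union> ?D) = {}" using disj by (simp only: Int_Un_distrib Un_empty_left)
  ultimately have "card (?B \<union> (?C \<union> ?D)) = 15" using card_Un_disjoint[of ?B "?C \<union> ?D"] cards by simp
  moreover have "?A \<inter> (?B \<union> (?C \<union> ?D)) = {}" using disj by (simp only: Int_Un_distrib Un_empty_left)
  ultimately have cU: "card ?U = 20" using card_Un_disjoint[of ?A "?B \<union> (?C \<union> ?D)"] cards by simp
  have "?U \<subseteq> vertices X"
    using face_in_vertices[OF A'] face_in_vertices[OF B] face_in_vertices[OF C] face_in_vertices[OF D]
    by simp
  then have U: "?U = vertices X" using cU card card_subset_eq[OF finite_cells(1)] by metis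
  have range: "range f = ?U" unfolding UNIV_label f_def by (simp add: insert_commute)
  have "card (range f) = card (UNIV :: label set)" unfolding range cU card_label ..
  then have "inj f" using eq_card_imp_inj_on[of UNIV f] finite_label by blast
  then have bij: "bij_betw f UNIV (vertices X)" unfolding bij_betw_def using range U by simp
  have rots: "face [x0, x1, x2, x3, x4] \<and> face [x1, x2, x3, x4, x0] \<and> face [x2, x3, x4, x0, x1] \<and>
     face [x3, x4, x0, x1, x2] \<and> face [x4, x0, x1, x2, x3]" if "face [x0, x1, x2, x3, x4]"
   for x0 x1 x2 x3 x4 using that face5_rotate by blast
  have "face (map f (pent l))" for l
    by (cases l) (use rots[OF A'] rots[OF B] rots[OF C] rots[OF D] in \<open>simp_all add: f_def\<close>)
  then have lab: "labelling f" using bij unfolding labelling_def by blast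
  have "face [v, n3, u2, n2]" "face [q, v, n3, u3]" using n(3,4) face4_rotate face4_flip by metis+
  then have "face4 f r" if "r \<in> set start" for r
    using that n(2) w1 unfolding start_def face4_def f_def by auto
  then show thesis using that lab by blast
qed

text \<open>The rules on edges and diagonals come from \<open>face_compat\<close>, the one on the
  faces around a vertex from \<open>rotation_pent\<close>.\<close>

lemma labelling_quad_labelling:
  assumes "labelling f"
  shows "quad_labelling (face4 f)"
proof -
  have bij: "bij_betw f UNIV (vertices X)" and P: "\<And>l. face (map f (pent l))"
    using assms unfolding labelling_def by auto
  have inj: "f a = f b \<longleftrightarrow> a = b" for a b using bij unfolding bij_betw_def inj_on_def by auto
  have P5: "\<exists>c d. face [f l, f (nxt l), f c, f d, f (prv l)] \<and> pent_diag l = [c, d]" for l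
    using P[of l] by (cases l) auto
  show ?thesis
  proof
    fix a b c d assume q: "face4 f (a, b, c, d)"
    then have F: "face [f a, f b, f c, f d]" unfolding face4_def by simp
    show "face4 f (b, c, d, a)" using face4_rotate[OF F] unfolding face4_def by simp
    show "face4 f (a, d, c, b)" using face4_flip[OF F] unfolding face4_def by simp
    show "distinct [a, b, c, d]" using face_distinct[OF F] by auto
    obtain r s where rs: "face [f a, f (nxt a), f r, f s, f (prv a)]" "pent_diag a = [r, s]"
      using P5 by blast
    show "b \<notin> set (pent_diag a)"
    proof
      assume "b \<in> set (pent_diag a)"
      then have b: "b = r \<or> b = s" using rs(2) by simp
      then have "pent_edge (f a) (f b)" using quad_edge_pent[OF F rs(1)] by auto
      then have "b = nxt a \<or> b = prv a" using pent_edge_iff[OF rs(1)] inj by blast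
      moreover have "distinct [nxt a, r, s, prv a]" using face_distinct[OF rs(1)] by auto
      ultimately show False using b by auto
    qed
    show "c \<notin> set (pent a)"
    proof
      assume "c \<in> set (pent a)"
      then have "{f a, f c} \<subseteq> {f a, f (nxt a), f r, f s, f (prv a)}"
        using set_pent[of a] rs(2) by auto
      then show False using quad_diag_pent[OF F rs(1)] by blast
    qed
    fix b' c' d' 
    { assume "face4 f (a, b', c', d')"
      then have G: "face [f a, f b', f c', f d']" unfolding face4_def by simp
      show "c \<noteq> b'"
      proof
        assume c: "c = b'"
        note nb = nbrs4[OF face_distinct[OF F], of "f c"]
        have "f c \<noteq> f b" "f c \<noteq> f d" using face_distinct[OF F] by auto
        then have no: "{f a, f c} \<notin> cycle_edges [f a, f b, f c, f d]" using nb by blast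
        moreover have "{f a, f c} \<in> cycle_edges [f a, f b', f c', f d']"
          unfolding c cycle_edges4 by simp
        \<comment> \<open>The pair is an edge of one face and a diagonal of the other, so the faces
          differ; \<open>face_compat\<close> would then make it an edge of both.\<close>
        ultimately have "cycle_edges [f a, f b, f c, f d] \<noteq> cycle_edges [f a, f b', f c', f d']" by metis
        then show False
          using face_compat[OF F G, of "f a" "f c"] no c face_distinct[OF F] by simp
      qed }
    { assume "face4 f (a, b', c, d')"
      then have G: "face [f a, f b', f c, f d']" unfolding face4_def by simp
      have "{f a, f c} \<notin> cycle_edges [f a, f b, f c, f d]"
        using nbrs4[OF face_distinct[OF F], of "f c"] face_distinct[OF F] by auto
      \<comment> \<open>Different faces could share this pair only as an edge, but it is a
        diagonal.\<close>
      then have "cycle_edges [f a, f b, f c, f d] = cycle_edges [f a, f b', f c, f d']"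
        using face_compat[OF F G, of "f a" "f c"] face_distinct[OF F] by auto
      then show "{b, d} = {b', d'}" using quad_eq[OF F G] inj by auto }
  next
    fix v
    obtain r s where rs: "face [f v, f (nxt v), f r, f s, f (prv v)]" using P5 by blast
    obtain n2 n3 u1 u2 u3 where n: "distinct [f (prv v), f (nxt v), n2, n3]"
      "face [f v, f (nxt v), u1, n2]" "face [f v, n2, u2, n3]" "face [f v, n3, u3, f (prv v)]"
      "\<forall>x u y. face [f v, x, u, y] \<longrightarrow> (x, u, y) \<in> {(f (nxt v), u1, n2), (n2, u1, f (nxt v)),
        (n2, u2, n3), (n3, u2, n2), (n3, u3, f (prv v)), (f (prv v), u3, n3)}"
      by (rule rotation_pent[OF rs])
    have "vertices X = range f" using bij unfolding bij_betw_def by simp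
    then have "{n2, n3, u1, u2, u3} \<subseteq> range f"
      using face_in_vertices[OF n(2)] face_in_vertices[OF n(3)] face_in_vertices[OF n(4)] by simp
    then obtain x y w1 w2 w3 where l: "n2 = f x" "n3 = f y" "u1 = f w1" "u2 = f w2" "u3 = f w3"
      by auto
    have "\<forall>b c d. face4 f (v, b, c, d) \<longrightarrow> {b, d} \<in> {{nxt v, x}, {x, y}, {y, prv v}}"
    proof (intro allI impI)
      fix b c d assume "face4 f (v, b, c, d)"
      then have "(f b, f c, f d) \<in> {(f (nxt v), u1, n2), (n2, u1, f (nxt v)),
        (n2, u2, n3), (n3, u2, n2), (n3, u3, f (prv v)), (f (prv v), u3, n3)}"
        using n(5) unfolding face4_def by simp
      then show "{b, d} \<in> {{nxt v, x}, {x, y}, {y, prv v}}" unfolding l by (auto simp: inj)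
    qed
    moreover have "face4 f (v, nxt v, w1, x)" "face4 f (v, x, w2, y)" "face4 f (v, y, w3, prv v)"
      using n(2-4) unfolding face4_def l by simp_all
    moreover have "x \<noteq> y" "x \<notin> {nxt v, prv v}" "y \<notin> {nxt v, prv v}"
      using n(1) unfolding l by auto
    ultimately show "\<exists>x y u1 u2 u3. x \<noteq> y \<and> x \<notin> {nxt v, prv v} \<and> y \<notin> {nxt v, prv v} \<and>
      face4 f (v, nxt v, u1, x) \<and> face4 f (v, x, u2, y) \<and> face4 f (v, y, u3, prv v) \<and>
      (\<forall>b c d. face4 f (v, b, c, d) \<longrightarrow> {b, d} \<in> {{nxt v, x}, {x, y}, {y, prv v}})" by blast
  qed
qed

section \<open>From a labelling to an isomorphism\<close>

lemma realized_isomorphic: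
  assumes f: "labelling f" and R: "quad_labelling.realized (face4 f) K"
    and K: "fst K = {1..20}" "\<And>vs. vs \<in> snd K \<Longrightarrow> set vs \<subseteq> {1..20}"
    and card: "card (faces X) = card (cycle_edges ` snd K)" 
  shows "isomorphic_to X K"
proof -
  interpret L: quad_labelling "face4 f" using labelling_quad_labelling[OF f] .
  have bij: "bij_betw f UNIV (vertices X)" and P: "\<And>l. face (map f (pent l))"
    using f unfolding labelling_def by auto
  obtain p where p: "length p = 20" "distinct p" "\<And>vs. vs \<in> snd K \<Longrightarrow> L.face_word (map (lookup p) vs)"
    using R unfolding L.realized_def by blast
  have "bij_betw (\<lambda>i. p ! i) {..<20} (set p)" using bij_betw_nth[OF p(2)] p(1) by simp
  moreover have "set p = UNIV"
    using card_subset_eq[OF finite_label, of "set p"] distinct_card[OF p(2)] p(1) card_label by simp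
  moreover have "bij_betw (\<lambda>n. n - 1) {1..20} {..<20::nat}"
    by (rule bij_betw_byWitness[where f' = Suc]) auto
  ultimately have "bij_betw ((\<lambda>i. p ! i) \<circ> (\<lambda>n. n - 1)) {1..20} UNIV"
    using bij_betw_trans by metis
  then have "bij_betw (lookup p) {1..20} UNIV" unfolding lookup_def comp_def .
  then have h: "bij_betw (f \<circ> lookup p) {1..20} (vertices X)" using bij bij_betw_trans by blast
  define b where "b = the_inv_into {1..20} (f \<circ> lookup p)"
  have b: "bij_betw b (vertices X) (fst K)" unfolding b_def K(1) by (rule bij_betw_the_inv_into[OF h])
  have b_inv: "b ((f \<circ> lookup p) i) = i" if "i \<in> {1..20}" for i
    unfolding b_def by (rule the_inv_into_f_f[OF bij_betw_imp_inj_on[OF h] that])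
  define \<Phi> where "\<Phi> F = image b ` boundary_cycle X F" for F
  have "cycle_edges vs \<in> \<Phi> ` faces X" if vs: "vs \<in> snd K" for vs
  proof -
    have "face (map f ws)" if "L.face_word ws" for ws
      using that unfolding L.face_word_def
    proof (elim disjE exE conjE)
      fix a b c d assume "ws = [a, b, c, d]" "face4 f (a, b, c, d)"
      then show ?thesis unfolding face4_def by simp
    next
      fix a b c d e assume "ws = [a, b, c, d, e]" "pent a = [a, b, c, d, e]"
      then show ?thesis using P[of a] by simp
    next
      fix a b c d e assume "ws = [a, b, c, d, e]" "pent a = [a, e, d, c, b]"
      then show ?thesis using P[of a] face5_flip by simp
    qed
    then have "face (map f (map (lookup p) vs))" using p(3)[OF vs] by blast
    then have "face (map (f \<circ> lookup p) vs)" by simp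
    then obtain F where F: "F \<in> faces X" "boundary_cycle X F = image (f \<circ> lookup p) ` cycle_edges vs"
      unfolding face_def cycle_edges_map by blast
    have "b ` (f \<circ> lookup p) ` e = e" if "e \<in> cycle_edges vs" for e
    proof -
      have "e \<subseteq> {1..20}" using that K(2)[OF vs] Union_cycle_edges[of vs] by blast
      then show ?thesis using b_inv by (force simp: image_image)
    qed
    then have "\<Phi> F = cycle_edges vs" unfolding \<Phi>_def F(2) image_image by simp
    then show ?thesis using F(1) by blast
  qed
  then have sub: "cycle_edges ` snd K \<subseteq> \<Phi> ` faces X" by blast
  have fin: "finite (\<Phi> ` faces X)" using finite_cells by simp
  \<comment> \<open>The image contains all listed cycles and cannot exceed their number. So the sets
    agree, and equality of the cardinalities also makes \<open>\<Phi>\<close> injective.\<close>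
  have "card (\<Phi> ` faces X) \<le> card (cycle_edges ` snd K)"
    using card_image_le[OF finite_cells(3), of \<Phi>] card by simp
  then have eq: "\<Phi> ` faces X = cycle_edges ` snd K" using card_seteq[OF fin sub] by simp
  then have "inj_on \<Phi> (faces X)"
    using card eq_card_imp_inj_on[OF finite_cells(3), of \<Phi>] by simp
  then have "bij_betw \<Phi> (faces X) (cycle_edges ` snd K)" unfolding bij_betw_def using eq by simp
  then show ?thesis unfolding isomorphic_to_def \<Phi>_def using b by blast
qed

end

lemma K_faces:
  assumes "K \<in> {K1, K2, K3}"
  shows "fst K = {1..20}" "vs \<in> snd K \<Longrightarrow> set vs \<subseteq> {1..20}" "card (cycle_edges ` snd K) = 19"
proof -
  show "fst K = {1..20}" using assms by (auto simp: K1_def K2_def K3_def)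
  show "set vs \<subseteq> {1..20}" if "vs \<in> snd K" using assms that by (auto simp: K1_def K2_def K3_def)
  have "card (snd K) = 19" using assms by (auto simp: K1_def K2_def K3_def)
  \<comment> \<open>The binary code of the vertex set is a fingerprint that arithmetic can compare.
    It depends only on the cycle, so different codes give different cycles.\<close>
  moreover have "inj_on (\<lambda>vs. \<Sum>x\<in>set vs. 2 ^ x :: nat) (snd K)"
    using assms by (auto simp: K1_def K2_def K3_def)
  then have "inj_on ((\<lambda>E. \<Sum>x\<in>\<Union>E. 2 ^ x :: nat) \<circ> cycle_edges) (snd K)"
    by (simp add: comp_def Union_cycle_edges)
  then have "inj_on cycle_edges (snd K)" by (rule inj_on_imageI2)
  ultimately show "card (cycle_edges ` snd K) = 19" by (simp add: card_image)
qed

theorem theorem1p2: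
  fixes X :: "'a cell_map"
  assumes "semi_equivelar [4, 4, 4, 5] X"
    and "euler_char X = -1"
  shows "isomorphic_to X K1 \<or> isomorphic_to X K2 \<or> isomorphic_to X K3"
proof -
  interpret map_4445 X using assms(1) by unfold_locales
  have card: "card (vertices X) = 20" "card (faces X) = 19"
    using card_vertices_faces assms(2) by auto
  obtain f where f: "labelling f" "\<And>q. q \<in> set start \<Longrightarrow> face4 f q"
    using labelling_exists[OF card(1)] by blast
  interpret L: quad_labelling "face4 f" using labelling_quad_labelling[OF f(1)] .
  have "L.realized K1 \<or> L.realized K2 \<or> L.realized K3"
    using L.search_sound(1)[OF search_cert] f(2) by blast
  moreover have "isomorphic_to X K" if "L.realized K" "K \<in> {K1, K2, K3}" for K
    by (rule realized_isomorphic[OF f(1) that(1)]) (use K_faces[OF that(2)] card(2) in auto)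
  ultimately show ?thesis by blast
qed

end
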